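(* Consider an additive orthogonal regression code with parameters $\{(c_l,\omega_l)\}_{l=1}^L$ under correlation-based greedy encoding, where the design matrix $A\in\mathbb{R}^{n\times N}$ has i.i.d. $\mathcal{N}(0,1)$ entries. Let $\sigma>0$. Then the deterministic centerings $D_0,\dots,D_L$ satisfy a recursion of the form $$D_0=\sigma^2,\qquad D_l=\Big(\sqrt{D_{l-1}}-\frac{\omega_l c_l}{\sqrt n}\Big)^2+c_l^2+\frac{\eta_l}{n},\quad l=1,\dots,L,$$ where $|\eta_l|\le 2\sum_{k=1}^l c_k^2$.
   Context: $\|\cdot\|$ is the Euclidean norm. Additive orthogonal regression code: nonempty finite sets $\mathcal{B}_1,\dots,\mathcal{B}_L\subset\mathbb{R}^N$ that are mutually orthogonal ($\langle b,b'\rangle=0$ for $b\in\mathcal{B}_l$, $b'\in\mathcal{B}_{l'}$, $l\ne l'$), with $\|b\|=c_l$ for every $b\in\mathcal{B}_l$, where $c_l>0$ is a constant. The codebook is $\{A\beta: \beta\in\mathcal{B}_1+\cdots+\mathcal{B}_L\}\subset\mathbb{R}^n$. Normalized Gaussian width: $\omega_l=\mathbb{E}\big[\max_{b\in\mathcal{B}_l}\langle z,b\rangle/\|b\|\big]$ with $z\sim\mathcal{N}(0,I_N)$. Correlation-based greedy encoding of a source vector $x\in\mathbb{R}^n$: set $\beta_0=0$, $r_0=x$, and for $l=1,\dots,L$, $$b_l\in\operatorname{arg\,max}_{b\in\mathcal{B}_l}\langle r_{l-1},Ab\rangle,\quad \beta_l=\beta_{l-1}+b_l,\quad r_l=x-A\beta_l,$$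 with ties broken by a fixed measurable rule that is a function of $(r_{l-1},(Ab)_{b\in\mathcal{B}_l})$ (for nonzero $x$, ties occur with probability zero). Deterministic centering: $D_l=\frac1n\big(\mathbb{E}\|r_l\|\big)^2$, where the encoder is run on a deterministic source $x\in\mathbb{R}^n$ with $\|x\|=\sqrt n\,\sigma$, e.g. $x=\sqrt n\,\sigma e_1$ (the value does not depend on which such $x$ is used). *)

theory Defs
  imports "HOL-Probability.Probability"
begin

text \<open>The number of rows \<open>n\<close> and columns \<open>N\<close> of the design matrix are \<open>CARD('n)\<close>
  and \<open>CARD('N)\<close>. Sections are indexed by \<open>l \<in> {1..L}\<close>; \<open>B 0\<close> and \<open>B l\<close> for \<open>l > L\<close>
  are irrelevant.\<close>

definition additive_orthogonal_code ::
    "nat \<Rightarrow> (nat \<Rightarrow> (real^'N::finite) set) \<Rightarrow> (nat \<Rightarrow> real) \<Rightarrow> bool" where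
  "additive_orthogonal_code L B c \<longleftrightarrow>
     (\<forall>l\<in>{1..L}. finite (B l) \<and> B l \<noteq> {} \<and> c l > 0 \<and> (\<forall>b\<in>B l. norm b = c l)) \<and>
     (\<forall>l\<in>{1..L}. \<forall>l'\<in>{1..L}. l \<noteq> l' \<longrightarrow> (\<forall>b\<in>B l. \<forall>b'\<in>B l'. inner b b' = 0))"

definition std_gaussian :: "(real^'N::finite) measure" where
  "std_gaussian = distr (PiM UNIV (\<lambda>_. density lborel std_normal_density)) borel vec_lambda"

definition gaussian_width :: "(real^'N::finite) set \<Rightarrow> real" where
  "gaussian_width S = (\<integral>z. Max ((\<lambda>b. inner z b / norm b) ` S) \<partial>std_gaussian)"

definition iid_std_normal_matrix :: "'a measure \<Rightarrow> ('a \<Rightarrow> real^'N::finite^'n::finite) \<Rightarrow> bool" where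
  "iid_std_normal_matrix M A \<longleftrightarrow>
     prob_space.indep_vars M (\<lambda>_. borel) (\<lambda>(i, j) w. A w $ i $ j) UNIV \<and>
     (\<forall>i j. distributed M lborel (\<lambda>w. A w $ i $ j) std_normal_density)"

text \<open>A selection rule receives the residual \<open>r\<close> and the family \<open>f = (A b)\<^sub>b\<close> indexed by
  \<open>b \<in> S\<close>. The family is an extensional function, so the rule cannot depend on \<open>A\<close> in any
  other way.\<close>

definition argmax_rule ::
    "(real^'N::finite) set \<Rightarrow> (real^'n::finite \<Rightarrow> (real^'N \<Rightarrow> real^'n) \<Rightarrow> real^'N) \<Rightarrow> bool" where
  "argmax_rule S T \<longleftrightarrow>
     (\<forall>r. \<forall>f\<in>extensional S. is_arg_max (\<lambda>b. inner r (f b)) (\<lambda>b. b \<in> S) (T r f)) \<and>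
     (\<lambda>(r, f). T r f) \<in> borel \<Otimes>\<^sub>M PiM S (\<lambda>_. borel) \<rightarrow>\<^sub>M borel"

primrec greedy_coeff ::
    "(nat \<Rightarrow> (real^'N::finite) set) \<Rightarrow>
     (nat \<Rightarrow> real^'n::finite \<Rightarrow> (real^'N \<Rightarrow> real^'n) \<Rightarrow> real^'N) \<Rightarrow>
     real^'N^'n \<Rightarrow> real^'n \<Rightarrow> nat \<Rightarrow> real^'N" where
  "greedy_coeff B T A x 0 = 0"
| "greedy_coeff B T A x (Suc l) = greedy_coeff B T A x l +
     T (Suc l) (x - A *v greedy_coeff B T A x l) (\<lambda>b\<in>B (Suc l). A *v b)"

definition greedy_residual ::
    "(nat \<Rightarrow> (real^'N::finite) set) \<Rightarrow>
     (nat \<Rightarrow> real^'n::finite \<Rightarrow> (real^'N \<Rightarrow> real^'n) \<Rightarrow> real^'N) \<Rightarrow>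
     real^'N^'n \<Rightarrow> real^'n \<Rightarrow> nat \<Rightarrow> real^'n" where
  "greedy_residual B T A x l = x - A *v greedy_coeff B T A x l"

definition centering ::
    "'a measure \<Rightarrow> ('a \<Rightarrow> real^'N::finite^'n::finite) \<Rightarrow> (nat \<Rightarrow> (real^'N) set) \<Rightarrow>
     (nat \<Rightarrow> real^'n \<Rightarrow> (real^'N \<Rightarrow> real^'n) \<Rightarrow> real^'N) \<Rightarrow>
     real^'n \<Rightarrow> nat \<Rightarrow> real" where
  "centering M A B T x l =
     1 / real CARD('n) * (\<integral>w. norm (greedy_residual B T (A w) x l) \<partial>M)\<^sup>2"

end

theory Submission
  imports Defs
begin

text \<open>Write \<open>R l\<close> for the norm of the \<open>l\<close>-th residual and \<open>m\<close> for the maximum of \<open>\<langle>g, b\<rangle>\<close> over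
  the \<open>l\<close>-th section, \<open>g\<close> standard Gaussian, so that \<open>E m = \<omega> l * c l\<close>. Orthogonality of the
  sections makes the columns \<open>A b\<close> of the \<open>l\<close>-th section independent of the previous residual, and
  rotation invariance gives
  \<open>(R l)\<^sup>2 = (R (l - 1) - m)\<^sup>2 + (c l)\<^sup>2 * chi\<close> in law, with \<open>R (l - 1)\<close>, \<open>m\<close> and the
  \<open>chi\<close>-square variable with \<open>n - 1\<close> degrees of freedom independent. Taking expectations yields
  \<open>\<eta> l = Var (R (l - 1)) - Var (R l) + Var m - (c l)\<^sup>2\<close>. Given \<open>R (l - 1)\<close>, both \<open>m\<close> and
  \<open>R l\<close> are \<open>c l\<close>-Lipschitz functions of Gaussian vectors, so the Poincare inequality bounds
  their variances by \<open>(c l)\<^sup>2\<close>; as \<open>R l\<close> is moreover 1-Lipschitz in \<open>R (l - 1)\<close>, also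
  \<open>Var (R l) \<le> Var (R (l - 1)) + (c l)\<^sup>2\<close>. These bounds control \<open>\<eta> l\<close>.\<close>

subsection \<open>The standard Gaussian measure on a Euclidean space\<close>

text \<open>A centering squares the mean of \<open>R l\<close>, whereas only the mean of
  \<open>(R l)\<^sup>2\<close> has a closed form after one step. Each variance in the error is the
  price of passing between the two and must be bounded independently of the dimensions, for
  functions that are not smooth. Every random object lives on a Euclidean space, matrices included,
  with the one measure \<open>gaussian\<close>. Independence is then a product type, and a linear
  image is again standard Gaussian as soon as the adjoint map is isometric, which is how most
  changes of variables are checked. For the same reason the chi-square variable is kept as the
  squared norm of a projected Gaussian vector: the next residual norm stays a Lipschitz function on
  such a space. The Poincare inequality is derived from rotation invariance, without integration by
  parts, and asks for differentiability almost everywhere only. A finite maximum of linear functions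
  has it away from ties, a norm away from zero; ties and zeros are shown to be null.\<close>

definition gaussian_density :: "'a::euclidean_space \<Rightarrow> real" where
  "gaussian_density x = (1 / sqrt (2 * pi)) ^ DIM('a) * exp (- (norm x)\<^sup>2 / 2)"

definition gaussian :: "'a::euclidean_space measure" where
  "gaussian = density lborel (\<lambda>x. ennreal (gaussian_density x))"

lemma gaussian_density_pos: "gaussian_density x > 0"
  by (simp add: gaussian_density_def)

lemma gaussian_density_nonneg: "gaussian_density x \<ge> 0"
  using gaussian_density_pos[of x] by simp

lemma gaussian_density_measurable [measurable]:
  "gaussian_density \<in> borel_measurable borel"
  unfolding gaussian_density_def by measurable

text \<open>The definition through the norm makes invariance under isometries immediate; this form
  connects the density with integrals over coordinates.\<close>

lemma gaussian_density_prod: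
  fixes x :: "'a::euclidean_space"
  shows "gaussian_density x = (\<Prod>b\<in>Basis. std_normal_density (x \<bullet> b))"
proof -
  have "(norm x)\<^sup>2 = (\<Sum>b\<in>Basis. (x \<bullet> b)\<^sup>2)"
    by (subst power2_norm_eq_inner, subst euclidean_inner) (simp add: power2_eq_square)
  then show ?thesis
    by (simp add: gaussian_density_def std_normal_density_def prod.distrib exp_sum [symmetric]
      sum_negf sum_divide_distrib [symmetric] power_divide prod_dividef)
qed

lemma gaussian_density_Pair:
  fixes x :: "'a::euclidean_space" and y :: "'b::euclidean_space"
  shows "gaussian_density (x, y) = gaussian_density x * gaussian_density y"
  by (simp add: gaussian_density_def norm_Pair power_add exp_add [symmetric] add_divide_distrib)

lemma sets_gaussian [measurable_cong, simp]: "sets gaussian = sets borel"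
  by (simp add: gaussian_def)

lemma space_gaussian [simp]: "space gaussian = UNIV"
  by (simp add: gaussian_def)

lemma gaussian_real: "(gaussian :: real measure) = density lborel std_normal_density"
  unfolding gaussian_def gaussian_density_prod by simp

lemma prob_space_std_normal: "prob_space (density lborel std_normal_density)"
  by (rule prob_space_normal_density) simp

lemma prob_space_gaussian: "prob_space (gaussian :: 'a::euclidean_space measure)"
proof
  have 1: "(\<integral>\<^sup>+x. ennreal (std_normal_density x) \<partial>lborel) = 1"
    using prob_space.emeasure_space_1[OF prob_space_std_normal] by (simp add: emeasure_density)
  have "emeasure gaussian (space (gaussian :: 'a measure)) =
      (\<integral>\<^sup>+(x::'a). (\<Prod>b\<in>Basis. ennreal (std_normal_density (x \<bullet> b))) \<partial>lborel)"
    by (simp add: gaussian_def emeasure_density gaussian_density_prod prod_ennreal)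
  also have "\<dots> = (\<Prod>b\<in>(Basis::'a set). (\<integral>\<^sup>+x. ennreal (std_normal_density x) \<partial>lborel))"
    by (rule nn_integral_lborel_prod) auto
  finally show "emeasure gaussian (space (gaussian :: 'a measure)) = 1"
    using 1 by simp
qed

interpretation gaussian: prob_space "gaussian :: 'a::euclidean_space measure"
  by (rule prob_space_gaussian)

text \<open>Two independent Gaussian vectors become one Gaussian vector on a product space, where
  isometries may mix the two factors.\<close>

lemma gaussian_pair:
  "(gaussian :: 'a::euclidean_space measure) \<Otimes>\<^sub>M (gaussian :: 'b::euclidean_space measure) = gaussian"
proof -
  have "(gaussian :: 'a measure) \<Otimes>\<^sub>M (gaussian :: 'b measure) =
     density (lborel \<Otimes>\<^sub>M lborel) (\<lambda>(x, y). ennreal (gaussian_density x) * ennreal (gaussian_density y))"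
    unfolding gaussian_def
    by (rule pair_measure_density)
       (auto intro: sigma_finite_lborel gaussian.sigma_finite_measure[unfolded gaussian_def])
  also have "\<dots> = gaussian"
    by (simp add: lborel_prod gaussian_def case_prod_unfold gaussian_density_nonneg
        flip: ennreal_mult gaussian_density_Pair)
  finally show ?thesis .
qed

section \<open>Invariance under isometries and coisometries\<close>

lemma nn_integral_lborel_translation:
  fixes a :: "'a::euclidean_space"
  assumes [measurable]: "f \<in> borel_measurable borel"
  shows "(\<integral>\<^sup>+x. f (a + x) \<partial>lborel) = (\<integral>\<^sup>+x. f x \<partial>lborel)"
proof -
  have "(\<integral>\<^sup>+x. f x \<partial>lborel) = (\<integral>\<^sup>+x. f x \<partial>distr lborel borel ((+) a))"
    by (simp add: lborel_distr_plus)
  then show ?thesis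
    by (simp add: nn_integral_distr)
qed

lemma nn_integral_lborel_reflect:
  fixes a :: "'a::euclidean_space"
  assumes [measurable]: "f \<in> borel_measurable borel"
  shows "(\<integral>\<^sup>+x. f (a - x) \<partial>lborel) = (\<integral>\<^sup>+x. f x \<partial>lborel)"
proof -
  have eq: "(lborel :: 'a measure) = density (distr lborel borel (\<lambda>x. a + (-1) *\<^sub>R x)) (\<lambda>_. 1)"
    using lborel_affine[of "-1" a] by simp
  have "(\<integral>\<^sup>+x. f x \<partial>lborel) = (\<integral>\<^sup>+x. f (a - x) \<partial>lborel)"
    by (subst eq) (simp add: nn_integral_density nn_integral_distr)
  then show ?thesis ..
qed

lemma linear_borel_measurable:
  fixes U :: "'a::euclidean_space \<Rightarrow> 'b::euclidean_space"
  assumes "linear U"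
  shows "U \<in> borel_measurable borel"
  using assms by (auto intro!: borel_measurable_continuous_onI linear_continuous_on
        simp: linear_conv_bounded_linear[symmetric])

lemma linear_isometry_inverse:
  fixes U :: "'a::euclidean_space \<Rightarrow> 'a"
  assumes "linear U" "\<And>x. norm (U x) = norm x"
  obtains V where "linear V" "\<And>x. U (V x) = x" "\<And>x. V (U x) = x"
proof -
  have "inj U"
    using assms by (simp add: linear_injective_0) (metis norm_eq_zero)
  then show ?thesis
    using linear_injective_isomorphism[OF assms(1)] that by blast
qed

text \<open>The Gaussian density is invariant under \<open>U\<close>, and comparing it with an arbitrary \<open>f\<close>
  through the integral of \<open>f (x + U y) * gaussian_density (U y)\<close> transfers this to Lebesgue
  measure.\<close>
lemma nn_integral_lborel_isometry:
  fixes U :: "'a::euclidean_space \<Rightarrow> 'a"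
  assumes lin: "linear U" and iso: "\<And>x. norm (U x) = norm x"
    and [measurable]: "f \<in> borel_measurable borel"
  shows "(\<integral>\<^sup>+x. f (U x) \<partial>lborel) = (\<integral>\<^sup>+x. f x \<partial>lborel)"
proof -
  obtain V where linV: "linear V" and UV: "\<And>x. U (V x) = x" and VU: "\<And>x. V (U x) = x"
    using linear_isometry_inverse[OF lin iso] by blast
  note [measurable] = linear_borel_measurable[OF lin] linear_borel_measurable[OF linV]
  let ?g = "\<lambda>x::'a. ennreal (gaussian_density x)"
  have gU: "?g (U y) = ?g y" for y
    by (simp add: gaussian_density_def iso)
  have [simp]: "integral\<^sup>N lborel ?g = 1"
    using gaussian.emeasure_space_1[where ?'a='a] by (simp add: gaussian_def emeasure_density)
  have "(\<integral>\<^sup>+x. f x \<partial>lborel) = (\<integral>\<^sup>+y. (\<integral>\<^sup>+x. f x * ?g (U y) \<partial>lborel) \<partial>lborel)"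
    by (simp add: nn_integral_multc nn_integral_cmult gU)
  also have "\<dots> = (\<integral>\<^sup>+y. (\<integral>\<^sup>+x. f (U y + x) * ?g (U y) \<partial>lborel) \<partial>lborel)"
    by (subst nn_integral_lborel_translation[where f = "\<lambda>x. f x * ?g (U _)"]) auto
  also have "\<dots> = (\<integral>\<^sup>+x. (\<integral>\<^sup>+y. f (U y + x) * ?g (U y) \<partial>lborel) \<partial>lborel)"
    by (rule lborel_pair.Fubini') simp
  \<comment> \<open>Translating \<open>y\<close> by \<open>V x\<close> moves the shift from
    \<open>f\<close> to the density, whose integral over \<open>x\<close> is again 1.\<close>
  also have "\<dots> = (\<integral>\<^sup>+x. (\<integral>\<^sup>+y. f (U y) * ?g (U y - x) \<partial>lborel) \<partial>lborel)"
  proof (rule nn_integral_cong)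
    fix x :: 'a
    have "(\<integral>\<^sup>+y. f (U y + x) * ?g (U y) \<partial>lborel) =
        (\<integral>\<^sup>+y. (\<lambda>y. f (U y) * ?g (U y - x)) (V x + y) \<partial>lborel)"
      by (simp add: linear_add[OF lin] UV add.commute)
    also have "\<dots> = (\<integral>\<^sup>+y. f (U y) * ?g (U y - x) \<partial>lborel)"
      by (rule nn_integral_lborel_translation) simp
    finally show "(\<integral>\<^sup>+y. f (U y + x) * ?g (U y) \<partial>lborel) =
        (\<integral>\<^sup>+y. f (U y) * ?g (U y - x) \<partial>lborel)" .
  qed
  also have "\<dots> = (\<integral>\<^sup>+y. (\<integral>\<^sup>+x. f (U y) * ?g (U y - x) \<partial>lborel) \<partial>lborel)"
    by (rule lborel_pair.Fubini') simp
  also have "\<dots> = (\<integral>\<^sup>+y. f (U y) \<partial>lborel)"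
    by (subst nn_integral_lborel_reflect[where f = "\<lambda>x. f (U _) * ?g x"])
       (auto simp: nn_integral_cmult)
  finally show ?thesis ..
qed

lemma gaussian_isometry:
  fixes U :: "'a::euclidean_space \<Rightarrow> 'a"
  assumes lin: "linear U" and iso: "\<And>x. norm (U x) = norm x"
  shows "distr gaussian borel U = gaussian"
proof (rule measure_eqI)
  note [measurable] = linear_borel_measurable[OF lin]
  fix S assume "S \<in> sets (distr gaussian borel U)"
  then have [measurable]: "S \<in> sets borel" by simp
  have "emeasure (distr gaussian borel U) S =
      (\<integral>\<^sup>+x. (\<lambda>x. ennreal (gaussian_density x) * indicator S x) (U x) \<partial>lborel)"
  proof -
    have "U -` S \<in> sets borel"
      using measurable_sets_borel[of U borel S] by simp
    then show ?thesis
      by (auto simp: emeasure_distr gaussian_def emeasure_density gaussian_density_def iso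
         intro!: nn_integral_cong split: split_indicator)
  qed
  also have "\<dots> = (\<integral>\<^sup>+x. ennreal (gaussian_density x) * indicator S x \<partial>lborel)"
    by (rule nn_integral_lborel_isometry) (auto simp: lin iso)
  also have "\<dots> = emeasure gaussian S"
    by (simp add: gaussian_def emeasure_density)
  finally show "emeasure (distr gaussian borel U) S = emeasure gaussian S" .
qed simp

lemma borel_measurable_fst_snd [measurable]:
  "fst \<in> borel_measurable (borel :: ('a::second_countable_topology \<times> 'b::second_countable_topology) measure)"
  "snd \<in> borel_measurable (borel :: ('a::second_countable_topology \<times> 'b::second_countable_topology) measure)"
  unfolding borel_prod [symmetric] by measurable

lemma distr_gaussian_fst: "distr (gaussian :: ('a::euclidean_space \<times> 'b::euclidean_space) measure) borel fst = gaussian"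
proof (rule measure_eqI)
  fix S :: "'a set" assume "S \<in> sets (distr (gaussian :: ('a \<times> 'b) measure) borel fst)"
  then have [measurable]: "S \<in> sets borel" by simp
  have "emeasure (distr (gaussian :: ('a \<times> 'b) measure) borel fst) S
      = emeasure (gaussian :: ('a \<times> 'b) measure) (S \<times> UNIV)"
    by (subst emeasure_distr) (auto simp: vimage_fst)
  also have "\<dots> = emeasure gaussian S * emeasure gaussian (UNIV :: 'b set)"
    by (simp add: gaussian.emeasure_pair_measure_Times flip: gaussian_pair)
  also have "\<dots> = emeasure gaussian S"
    using gaussian.emeasure_space_1[where ?'a='b] by simp
  finally show "emeasure (distr (gaussian :: ('a \<times> 'b) measure) borel fst) S = emeasure gaussian S" .
qed simp

lemma distr_gaussian_snd: "distr (gaussian :: ('a::euclidean_space \<times> 'b::euclidean_space) measure) borel snd = gaussian"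
proof (rule measure_eqI)
  fix S :: "'b set" assume "S \<in> sets (distr (gaussian :: ('a \<times> 'b) measure) borel snd)"
  then have [measurable]: "S \<in> sets borel" by simp
  have "emeasure (distr (gaussian :: ('a \<times> 'b) measure) borel snd) S
      = emeasure (gaussian :: ('a \<times> 'b) measure) (UNIV \<times> S)"
    by (subst emeasure_distr) (auto simp: vimage_snd)
  also have "\<dots> = emeasure gaussian (UNIV :: 'a set) * emeasure gaussian S"
    by (simp add: gaussian.emeasure_pair_measure_Times flip: gaussian_pair)
  also have "\<dots> = emeasure gaussian S"
    using gaussian.emeasure_space_1[where ?'a='a] by simp
  finally show "emeasure (distr (gaussian :: ('a \<times> 'b) measure) borel snd) S = emeasure gaussian S" .
qed simp

text \<open>\<open>U\<close> is the second component of the isometry of the product space that exchanges the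
  range of \<open>V\<close> with the second factor.\<close>
lemma gaussian_coisometry:
  fixes U :: "'a::euclidean_space \<Rightarrow> 'b::euclidean_space"
  assumes adj: "\<And>x y. U x \<bullet> y = x \<bullet> V y" and iso: "\<And>y. norm (V y) = norm y"
    and linU: "linear U"
  shows "distr gaussian borel U = gaussian"
proof -
  have linV: "linear V"
    using adj adjoint_linear[OF linU] adjoint_unique[of U V] by simp
  have VV: "V x \<bullet> V y = x \<bullet> y" for x y
    using iso[of "x + y"] iso[of x] iso[of y]
    by (simp add: norm_eq_sqrt_inner linear_add[OF linV] algebra_simps inner_commute)
  have UV: "U (V y) = y" for y
    by (metis VV adj inner_commute vector_eq_ldot)
  note [measurable] = linear_borel_measurable[OF linU] linear_borel_measurable[OF linV]
  define W where "W = (\<lambda>(x, y). (x + V (y - U x), U x))"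
  have linW: "linear W"
    unfolding W_def case_prod_unfold
    by (rule linearI)
       (simp_all add: linear_add[OF linU] linear_add[OF linV] linear_diff[OF linV]
          linear_scale[OF linU] linear_scale[OF linV] algebra_simps)
  have isoW: "norm (W p) = norm p" for p
  proof -
    obtain x y where p: "p = (x, y)" by (cases p)
    have "(x + V (y - U x)) \<bullet> (x + V (y - U x)) + U x \<bullet> U x
        = x \<bullet> x + 2 * (x \<bullet> V (y - U x)) + V (y - U x) \<bullet> V (y - U x) + U x \<bullet> U x"
      by (simp add: inner_add inner_commute)
    also have "\<dots> = x \<bullet> x + 2 * (U x \<bullet> (y - U x)) + (y - U x) \<bullet> (y - U x) + U x \<bullet> U x"
      by (simp only: VV adj)
    also have "\<dots> = x \<bullet> x + y \<bullet> y"
      by (simp add: inner_diff inner_commute)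
    finally have "(x + V (y - U x)) \<bullet> (x + V (y - U x)) + U x \<bullet> U x = x \<bullet> x + y \<bullet> y" .
    then show ?thesis
      by (simp add: p W_def norm_eq_sqrt_inner)
  qed
  have [measurable]: "W \<in> borel_measurable borel"
    by (rule linear_borel_measurable[OF linW])
  have sndW: "snd \<circ> W = U \<circ> fst"
    by (auto simp: W_def fun_eq_iff)
  have "distr gaussian borel U = distr (distr (gaussian :: ('a \<times> 'b) measure) borel fst) borel U"
    by (simp only: distr_gaussian_fst)
  also have "\<dots> = distr gaussian borel (snd \<circ> W)"
    by (simp add: distr_distr sndW)
  also have "\<dots> = distr (distr gaussian borel W) borel snd"
    by (simp add: distr_distr)
  also have "\<dots> = gaussian"
    by (simp only: gaussian_isometry[OF linW isoW] distr_gaussian_snd)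
  finally show ?thesis .
qed

section \<open>Marginals, second moments and null hyperplanes\<close>

lemma gaussian_inner_unit:
  fixes b :: "'a::euclidean_space"
  assumes "norm b = 1"
  shows "distr gaussian borel (\<lambda>x. x \<bullet> b) = (gaussian :: real measure)"
  by (rule gaussian_coisometry[where V = "\<lambda>y. y *\<^sub>R b"])
     (auto simp: assms bounded_linear.linear[OF bounded_linear_inner_left])

lemma integrable_gaussian_real_square:
  "integrable (gaussian :: real measure) (\<lambda>x. x\<^sup>2)"
  and integral_gaussian_real_square: "(\<integral>x. x\<^sup>2 \<partial>(gaussian :: real measure)) = 1"
  using std_normal_moment_even[of 1]
  by (auto simp: gaussian_real integrable_density integral_density has_bochner_integral_iff fact_numeral)

lemma integrable_gaussian_inner_square:
    "integrable gaussian (\<lambda>x::'a::euclidean_space. (x \<bullet> b)\<^sup>2)" (is ?A)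
  and integral_gaussian_inner_square:
    "(\<integral>x. (x \<bullet> b)\<^sup>2 \<partial>(gaussian :: 'a measure)) = (norm b)\<^sup>2" (is ?B)
proof -
  have "?A \<and> ?B"
  proof (cases "b = 0")
    case False
    define u where "u = b /\<^sub>R norm b"
    have u: "norm u = 1" and b: "b = norm b *\<^sub>R u"
      using False by (auto simp: u_def)
    have eq: "(x \<bullet> b)\<^sup>2 = (norm b)\<^sup>2 * (x \<bullet> u)\<^sup>2" for x :: 'a
      by (subst b) (simp add: power_mult_distrib)
    have "integrable gaussian (\<lambda>x::'a. (x \<bullet> u)\<^sup>2)"
      using integrable_gaussian_real_square unfolding gaussian_inner_unit[OF u, symmetric]
      by (subst (asm) integrable_distr_eq) auto
    moreover have "(\<integral>x. (x \<bullet> u)\<^sup>2 \<partial>gaussian) = 1"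
      using integral_gaussian_real_square unfolding gaussian_inner_unit[OF u, symmetric]
      by (subst (asm) integral_distr) auto
    ultimately show ?thesis
      by (simp add: eq)
  qed simp
  then show ?A ?B by auto
qed

lemma norm_square_Basis:
  fixes x :: "'a::euclidean_space"
  shows "(norm x)\<^sup>2 = (\<Sum>b\<in>Basis. (x \<bullet> b)\<^sup>2)"
  by (subst power2_norm_eq_inner, subst euclidean_inner) (simp add: power2_eq_square)

lemma integrable_gaussian_norm_square:
    "integrable gaussian (\<lambda>x::'a::euclidean_space. (norm x)\<^sup>2)"
  and integral_gaussian_norm_square:
    "(\<integral>x. (norm x)\<^sup>2 \<partial>(gaussian :: 'a measure)) = DIM('a)"
  by (simp_all only: norm_square_Basis)
     (simp_all add: integrable_gaussian_inner_square integral_gaussian_inner_square)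

text \<open>Reduces to a single point under a one-dimensional marginal. Both a tie between codewords
  and a vanishing residual force the Gaussian vector onto one of finitely many such
  hyperplanes.\<close>

lemma AE_gaussian_inner_neq:
  fixes b :: "'a::euclidean_space"
  assumes "b \<noteq> 0"
  shows "AE x in gaussian. x \<bullet> b \<noteq> t"
proof -
  define u where "u = b /\<^sub>R norm b"
  have u: "norm u = 1" and b: "b = norm b *\<^sub>R u"
    using assms by (auto simp: u_def)
  have "AE y in (gaussian :: real measure). y \<noteq> t / norm b"
    unfolding gaussian_def
    by (subst AE_density, simp, rule eventually_mono[OF AE_lborel_singleton[of "t / norm b"]], simp)
  then have "AE y in distr gaussian borel (\<lambda>x. x \<bullet> u). y \<noteq> t / norm b"
    by (simp only: gaussian_inner_unit[OF u])
  then have "AE x in gaussian. x \<bullet> u \<noteq> t / norm b"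
    by (rule AE_distrD[rotated]) simp
  then show ?thesis
  proof (rule eventually_mono)
    fix x assume "x \<bullet> u \<noteq> t / norm b"
    moreover have "x \<bullet> u = (x \<bullet> b) / norm b"
      by (simp add: u_def divide_inverse)
    ultimately show "x \<bullet> b \<noteq> t"
      by auto
  qed
qed

section \<open>Lipschitz functions of a Gaussian vector\<close>

lemma lipschitz_abs_diff_le:
  fixes f :: "'a::real_normed_vector \<Rightarrow> real"
  assumes "L-lipschitz_on UNIV f"
  shows "\<bar>f x - f y\<bar> \<le> L * norm (x - y)"
  using lipschitz_onD[OF assms, of x y] by (simp add: dist_norm)

lemma lipschitz_borel_measurable:
  fixes f :: "'a::euclidean_space \<Rightarrow> real"
  assumes "L-lipschitz_on UNIV f"
  shows "f \<in> borel_measurable borel"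
  by (intro borel_measurable_continuous_onI lipschitz_on_continuous_on[OF assms])

lemma square_add_le: "(a + b)\<^sup>2 \<le> 2 * a\<^sup>2 + 2 * (b\<^sup>2 :: real)"
  using zero_le_power2[of "a - b"] by (simp add: power2_sum power2_diff)

lemma integrable_gaussian_lipschitz_square:
  fixes f :: "'a::euclidean_space \<Rightarrow> real"
  assumes "L-lipschitz_on UNIV f"
  shows "integrable gaussian (\<lambda>x. (f x)\<^sup>2)"
proof (rule Bochner_Integration.integrable_bound)
  show "integrable gaussian (\<lambda>x::'a. 2 * (f 0)\<^sup>2 + 2 * (L\<^sup>2 * (norm x)\<^sup>2))"
    by (intro Bochner_Integration.integrable_add integrable_mult_right
        integrable_gaussian_norm_square) auto
  show "(\<lambda>x. (f x)\<^sup>2) \<in> borel_measurable gaussian"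
    using lipschitz_borel_measurable[OF assms] by simp
  have "(f x)\<^sup>2 \<le> 2 * (f 0)\<^sup>2 + 2 * (L\<^sup>2 * (norm x)\<^sup>2)" for x
  proof -
    have "(f x - f 0)\<^sup>2 \<le> (L * norm x)\<^sup>2"
      using power_mono[OF lipschitz_abs_diff_le[OF assms, of x 0], of 2] by simp
    then show ?thesis
      using square_add_le[of "f 0" "f x - f 0"] by (simp add: power_mult_distrib)
  qed
  then show "AE x in gaussian. norm ((f x)\<^sup>2) \<le> norm (2 * (f 0)\<^sup>2 + 2 * (L\<^sup>2 * (norm x)\<^sup>2))"
    by simp
qed

lemma integrable_gaussian_lipschitz:
  fixes f :: "'a::euclidean_space \<Rightarrow> real"
  assumes "L-lipschitz_on UNIV f"
  shows "integrable gaussian f"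
proof (rule gaussian.square_integrable_imp_integrable)
  note [measurable] = lipschitz_borel_measurable[OF assms]
  show "f \<in> borel_measurable gaussian"
    by measurable
qed (rule integrable_gaussian_lipschitz_square[OF assms])

subsection \<open>The Gaussian Poincare inequality for Lipschitz functions\<close>

text \<open>The two arguments of \<open>f\<close> are standard Gaussian vectors with coordinatewise
  correlation \<open>\<rho>\<close>. Up to a factor 2 this is the quadratic form of the identity
  minus the Ornstein-Uhlenbeck (Mehler) operator with parameter \<open>\<rho>\<close>.\<close>

definition correlated_energy :: "('a::euclidean_space \<Rightarrow> real) \<Rightarrow> real \<Rightarrow> real" where
  "correlated_energy f \<rho> =
    (\<integral>(x, y). (f x - f (\<rho> *\<^sub>R x + sqrt (1 - \<rho>\<^sup>2) *\<^sub>R y))\<^sup>2 \<partial>gaussian)"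

text \<open>Unit coefficient triples act as points of a sphere: the corresponding combinations of
  three independent Gaussian vectors are standard Gaussian, with correlation the inner product of
  the triples. Three vectors are taken because the spherical square used for doubling spans three
  dimensions.\<close>

definition lin_comb3 :: "real \<times> real \<times> real \<Rightarrow> 'a::real_vector \<times> 'a \<times> 'a \<Rightarrow> 'a" where
  "lin_comb3 = (\<lambda>(a1, a2, a3) (y1, y2, y3). a1 *\<^sub>R y1 + a2 *\<^sub>R y2 + a3 *\<^sub>R y3)"

lemma lin_comb3_linear: "linear (lin_comb3 a)"
  by (rule linearI) (auto simp: lin_comb3_def algebra_simps split: prod.splits)

lemma lin_comb3_bilinear:
  "lin_comb3 (r *\<^sub>R a + s *\<^sub>R b) y = r *\<^sub>R lin_comb3 a y + s *\<^sub>R lin_comb3 b y"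
  by (auto simp: lin_comb3_def algebra_simps split: prod.splits)

lemma lipschitz_lin_comb3:
  fixes f :: "'a::euclidean_space \<Rightarrow> real"
  assumes "L-lipschitz_on UNIV f"
  obtains L' where "L'-lipschitz_on UNIV (\<lambda>y. f (lin_comb3 a y))"
proof -
  have "bounded_linear (lin_comb3 a :: 'a \<times> 'a \<times> 'a \<Rightarrow> 'a)"
    using lin_comb3_linear linear_conv_bounded_linear by blast
  then obtain B where "B-lipschitz_on UNIV (lin_comb3 a :: 'a \<times> 'a \<times> 'a \<Rightarrow> 'a)"
    using bounded_linear.lipschitz_boundE by blast
  then have "(L * B)-lipschitz_on UNIV (f \<circ> lin_comb3 a)"
    by (rule lipschitz_on_compose) (rule lipschitz_on_subset[OF assms], simp)
  then show ?thesis
    using that by (simp add: o_def)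
qed

lemma gaussian_orthonormal_pair:
  fixes a b :: "real \<times> real \<times> real"
  assumes "a \<bullet> a = 1" "b \<bullet> b = 1" "a \<bullet> b = 0"
  shows "distr gaussian borel (\<lambda>y. (lin_comb3 a y, lin_comb3 b y :: 'a::euclidean_space)) = gaussian"
proof -
  obtain a1 a2 a3 b1 b2 b3 where ab: "a = (a1, a2, a3)" "b = (b1, b2, b3)"
    by (metis prod_cases3)
  let ?V = "\<lambda>(p :: 'a, q). (a1 *\<^sub>R p + b1 *\<^sub>R q, a2 *\<^sub>R p + b2 *\<^sub>R q, a3 *\<^sub>R p + b3 *\<^sub>R q)"
  show ?thesis
  proof (rule gaussian_coisometry)
    show "(lin_comb3 a x, lin_comb3 b x) \<bullet> y = x \<bullet> ?V y" for x :: "'a \<times> 'a \<times> 'a" and y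
      by (auto simp: ab lin_comb3_def algebra_simps split: prod.splits)
    show "norm (?V y) = norm y" for y
    proof -
      obtain p q where y: "y = (p, q)" by (cases y)
      have sq: "(s *\<^sub>R p + t *\<^sub>R q) \<bullet> (s *\<^sub>R p + t *\<^sub>R q) =
          s * s * (p \<bullet> p) + t * t * (q \<bullet> q) + 2 * (s * t) * (p \<bullet> q)" for s t
        by (simp add: inner_add inner_commute[of q p]) (simp add: algebra_simps)
      have "?V y \<bullet> ?V y = (a \<bullet> a) * (p \<bullet> p) + (b \<bullet> b) * (q \<bullet> q) + 2 * (a \<bullet> b) * (p \<bullet> q)"
        by (simp add: y ab sq) (simp add: distrib_left distrib_right)
      then show ?thesis
        using assms by (simp add: y norm_eq_sqrt_inner)
    qed
    show "linear (\<lambda>y. (lin_comb3 a y, lin_comb3 b y :: 'a))"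
      by (rule linearI)
         (auto simp: linear_add[OF lin_comb3_linear] linear_scale[OF lin_comb3_linear])
  qed
qed

text \<open>Gram-Schmidt writes \<open>b\<close> as a combination of \<open>a\<close> and a unit
  vector \<open>d\<close> orthogonal to it, so the joint law depends on \<open>a \<bullet> b\<close>
  only. The strict bound on \<open>a \<bullet> b\<close> permits the normalization of
  \<open>d\<close>.\<close>

lemma integral_gaussian_correlated:
  fixes f :: "'a::euclidean_space \<Rightarrow> real" and a b :: "real \<times> real \<times> real"
  assumes [measurable]: "f \<in> borel_measurable borel"
    and a: "a \<bullet> a = 1" and b: "b \<bullet> b = 1" and ab: "\<bar>a \<bullet> b\<bar> < 1"
  shows "(\<integral>y. (f (lin_comb3 a y) - f (lin_comb3 b y))\<^sup>2 \<partial>gaussian) = correlated_energy f (a \<bullet> b)"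
proof -
  define \<rho> where "\<rho> = a \<bullet> b"
  define \<kappa> where "\<kappa> = sqrt (1 - \<rho>\<^sup>2)"
  have k: "\<kappa> > 0" "\<kappa>\<^sup>2 = 1 - \<rho>\<^sup>2"
    using ab by (simp_all add: \<kappa>_def \<rho>_def abs_square_less_1 less_imp_le)
  define d where "d = (b - \<rho> *\<^sub>R a) /\<^sub>R \<kappa>"
  have "a \<bullet> d = 0"
    using a by (simp add: d_def inner_diff_right \<rho>_def)
  moreover have "(b - \<rho> *\<^sub>R a) \<bullet> (b - \<rho> *\<^sub>R a) = 1 - \<rho>\<^sup>2"
    using a b by (simp add: inner_diff inner_commute \<rho>_def power2_eq_square)
  then have "d \<bullet> d = 1"
    using k by (simp add: d_def) (simp add: field_simps power2_eq_square)
  ultimately have distr: "distr gaussian borel (\<lambda>y. (lin_comb3 a y, lin_comb3 d y :: 'a)) = gaussian"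
    using a by (intro gaussian_orthonormal_pair)
  have bd: "b = \<rho> *\<^sub>R a + \<kappa> *\<^sub>R d"
    using k by (simp add: d_def)
  have [measurable]: "(\<lambda>y. (lin_comb3 a y, lin_comb3 d y :: 'a)) \<in> borel_measurable borel"
    by (rule linear_borel_measurable, rule linearI)
       (auto simp: linear_add[OF lin_comb3_linear] linear_scale[OF lin_comb3_linear])
  then have [measurable]: "(\<lambda>y. (lin_comb3 a y, lin_comb3 d y :: 'a)) \<in> gaussian \<rightarrow>\<^sub>M borel \<Otimes>\<^sub>M borel"
    by (simp only: borel_prod measurable_cong_sets[OF sets_gaussian refl])
  have "correlated_energy f \<rho> = (\<integral>(x, y). (f x - f (\<rho> *\<^sub>R x + \<kappa> *\<^sub>R y))\<^sup>2
      \<partial>distr gaussian borel (\<lambda>y. (lin_comb3 a y, lin_comb3 d y :: 'a)))"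
    by (simp only: distr correlated_energy_def \<kappa>_def)
  also have "\<dots> = (\<integral>y. (f (lin_comb3 a y) - f (lin_comb3 b y))\<^sup>2 \<partial>gaussian)"
    by (subst integral_distr) (auto simp: bd lin_comb3_bilinear borel_prod[symmetric] intro!: Bochner_Integration.integral_cong)
  finally show ?thesis
    by (simp add: \<rho>_def)
qed

text \<open>In the quadrilateral with consecutive vertices \<open>p\<close>, \<open>r\<close>,
  \<open>q\<close>, \<open>s\<close>, the squared sides exceed the squared diagonals by the square
  of \<open>p + q - r - s\<close>. No other inequality enters the doubling argument.\<close>

lemma square_four_points:
  fixes p q r s :: real
  shows "(p - q)\<^sup>2 + (r - s)\<^sup>2 \<le> (p - r)\<^sup>2 + (p - s)\<^sup>2 + (q - r)\<^sup>2 + (q - s)\<^sup>2"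
  using zero_le_power2[of "p + q - r - s"] by (simp add: power2_eq_square algebra_simps)

text \<open>Applies the preceding inequality to four points forming a spherical square, whose sides
  have correlation \<open>1 - \<tau>\<close> and whose diagonals have correlation \<open>1 - 2 * \<tau>\<close>.\<close>
lemma correlated_energy_double:
  fixes f :: "'a::euclidean_space \<Rightarrow> real"
  assumes lip: "L-lipschitz_on UNIV f" and t: "0 < \<tau>" "\<tau> < 1"
  shows "correlated_energy f (1 - 2 * \<tau>) \<le> 2 * correlated_energy f (1 - \<tau>)"
proof -
  let ?a = "sqrt (1 - \<tau>)" and ?s = "sqrt \<tau>"
  let ?p = "(?a, ?s, 0)" and ?q = "(?a, - ?s, 0)" and ?r = "(?a, 0, ?s)" and ?t = "(?a, 0, - ?s)"
  let ?D = "\<lambda>u v y. (f (lin_comb3 u y) - f (lin_comb3 v y))\<^sup>2"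
  have E: "(\<integral>y. ?D u v y \<partial>gaussian) = correlated_energy f \<rho>"
    if "u \<bullet> u = 1" "v \<bullet> v = 1" "u \<bullet> v = \<rho>" "\<bar>\<rho>\<bar> < 1" for u v \<rho>
    using integral_gaussian_correlated[OF lipschitz_borel_measurable[OF lip], of u v] that by simp
  have I: "integrable gaussian (?D u v)" for u v
  proof -
    obtain A where A: "A-lipschitz_on UNIV (\<lambda>y. f (lin_comb3 u y))"
      using lipschitz_lin_comb3[OF lip] by blast
    obtain B where B: "B-lipschitz_on UNIV (\<lambda>y. f (lin_comb3 v y))"
      using lipschitz_lin_comb3[OF lip] by blast
    show ?thesis
      using integrable_gaussian_lipschitz_square[OF lipschitz_on_diff[OF A B]] .
  qed
  have sq: "?a * ?a = 1 - \<tau>" "?s * ?s = \<tau>"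
    using t by auto
  have diag: "(\<integral>y. ?D ?p ?q y \<partial>gaussian) = correlated_energy f (1 - 2 * \<tau>)"
    "(\<integral>y. ?D ?r ?t y \<partial>gaussian) = correlated_energy f (1 - 2 * \<tau>)"
    using t by (auto intro!: E simp: sq)
  have side: "(\<integral>y. ?D ?p ?r y \<partial>gaussian) = correlated_energy f (1 - \<tau>)"
    "(\<integral>y. ?D ?p ?t y \<partial>gaussian) = correlated_energy f (1 - \<tau>)"
    "(\<integral>y. ?D ?q ?r y \<partial>gaussian) = correlated_energy f (1 - \<tau>)"
    "(\<integral>y. ?D ?q ?t y \<partial>gaussian) = correlated_energy f (1 - \<tau>)"
    using t by (auto intro!: E simp: sq)
  have "(\<integral>y. ?D ?p ?q y + ?D ?r ?t y \<partial>gaussian) \<le>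
      (\<integral>y. ?D ?p ?r y + ?D ?p ?t y + ?D ?q ?r y + ?D ?q ?t y \<partial>gaussian)"
    by (intro integral_mono Bochner_Integration.integrable_add I square_four_points)
  then show ?thesis
    by (simp add: I diag side)
qed

text \<open>Along the correlations \<open>1 - 1 / 2 ^ j\<close> the energy divided by
  \<open>1 - \<rho>\<close> never decreases. The case \<open>j = 0\<close> is correlation 0, so the
  variance is compared with difference quotients of \<open>f\<close> at ever smaller scales.\<close>

lemma correlated_energy_0_le:
  fixes f :: "'a::euclidean_space \<Rightarrow> real"
  assumes lip: "L-lipschitz_on UNIV f"
  shows "correlated_energy f 0 \<le> 2 ^ j * correlated_energy f (1 - 1 / 2 ^ j)"
proof (induction j)
  case (Suc j)
  have "correlated_energy f (1 - 1 / 2 ^ j) \<le> 2 * correlated_energy f (1 - 1 / 2 ^ Suc j)"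
    using correlated_energy_double[OF lip, of "1 / 2 ^ Suc j"] power_gt1[of "2::real" j]
    by (simp add: divide_less_eq)
  then have "2 ^ j * correlated_energy f (1 - 1 / 2 ^ j)
      \<le> 2 ^ j * (2 * correlated_energy f (1 - 1 / 2 ^ Suc j))"
    by (intro mult_left_mono) auto
  with Suc.IH show ?case
    unfolding power_Suc2 mult.assoc by (rule order_trans)
qed simp

interpretation gaussian_pair: pair_prob_space
  "gaussian :: 'a::euclidean_space measure" "gaussian :: 'b::euclidean_space measure" ..

lemma integral_gaussian_pair:
  fixes f :: "'a::euclidean_space \<times> 'b::euclidean_space \<Rightarrow> real"
  assumes "integrable gaussian f"
  shows "(\<integral>p. f p \<partial>gaussian) = (\<integral>x. (\<integral>y. f (x, y) \<partial>gaussian) \<partial>gaussian)"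
  using gaussian_pair.integral_fst'[of f] assms by (simp add: gaussian_pair)

text \<open>Differentiability handles the fixed direction \<open>v\<close>; replacing it by the
  moving direction \<open>w j\<close> costs at most \<open>L * norm (w j - v)\<close> after division
  by \<open>t j\<close>.\<close>

lemma lipschitz_directional_derivative:
  fixes f :: "'a::euclidean_space \<Rightarrow> real"
  assumes lip: "L-lipschitz_on UNIV f" and D: "(f has_derivative D) (at x)"
    and t0: "t \<longlonglongrightarrow> 0" and t_pos: "\<And>j. t j > 0" and w: "w \<longlonglongrightarrow> v"
  shows "(\<lambda>j. (f (x + t j *\<^sub>R w j) - f x) / t j) \<longlonglongrightarrow> D v"
proof -
  have "((\<lambda>s. f (x + s *\<^sub>R v)) has_derivative (\<lambda>s. D (s *\<^sub>R v))) (at 0)"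
    by (rule has_derivative_compose[where g = f, of "\<lambda>s. x + s *\<^sub>R v" "\<lambda>s. s *\<^sub>R v" 0 UNIV, simplified])
       (auto intro!: derivative_eq_intros D)
  moreover have "D (s *\<^sub>R v) = s * D v" for s
    using linear_scale[OF has_derivative_linear[OF D]] by simp
  ultimately have "((\<lambda>s. f (x + s *\<^sub>R v)) has_real_derivative D v) (at 0)"
    by (simp add: has_field_derivative_def mult.commute[of _ "D v"])
  then have "((\<lambda>s. (f (x + s *\<^sub>R v) - f x) / s) \<longlongrightarrow> D v) (at 0)"
    by (simp add: DERIV_def)
  moreover have "filterlim t (at 0) sequentially"
    using t0 t_pos by (auto simp: filterlim_at intro!: always_eventually) (metis less_irrefl)
  ultimately have *: "(\<lambda>j. (f (x + t j *\<^sub>R v) - f x) / t j) \<longlonglongrightarrow> D v"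
    by (rule filterlim_compose)
  have "(\<lambda>j. (f (x + t j *\<^sub>R w j) - f (x + t j *\<^sub>R v)) / t j) \<longlonglongrightarrow> 0"
  proof (rule Lim_null_comparison)
    show "(\<lambda>j. L * norm (w j - v)) \<longlonglongrightarrow> 0"
      using tendsto_mult_right_zero[OF tendsto_norm_zero[OF LIM_zero[OF w]]] .
    have "\<bar>f (x + t j *\<^sub>R w j) - f (x + t j *\<^sub>R v)\<bar> \<le> L * (t j * norm (w j - v))" for j
      using lipschitz_abs_diff_le[OF lip, of "x + t j *\<^sub>R w j" "x + t j *\<^sub>R v"] t_pos[of j]
      by (simp flip: scaleR_diff_right)
    then have "norm ((f (x + t j *\<^sub>R w j) - f (x + t j *\<^sub>R v)) / t j) \<le> L * norm (w j - v)" for j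
      using t_pos[of j] by (simp add: abs_of_pos divide_le_eq mult_ac)
    then show "\<forall>\<^sub>F j in sequentially.
        norm ((f (x + t j *\<^sub>R w j) - f (x + t j *\<^sub>R v)) / t j) \<le> L * norm (w j - v)"
      by simp
  qed
  from tendsto_add[OF this *] show ?thesis
    by (simp add: diff_divide_distrib)
qed

lemma lipschitz_gradient:
  fixes f :: "'a::euclidean_space \<Rightarrow> real"
  assumes lip: "L-lipschitz_on UNIV f" and D: "(f has_derivative D) (at x)"
  obtains d where "\<And>h. D h = h \<bullet> d" "norm d \<le> L"
proof -
  define d where "d = adjoint D 1"
  have Dd: "D h = h \<bullet> d" for h
    using adjoint_works[OF has_derivative_linear[OF D], of h 1] by (simp add: d_def inner_commute)
  \<comment> \<open>Differentiating along the gradient itself compares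
    \<open>norm d * norm d\<close> with \<open>L * norm d\<close>.\<close>
  have "(\<lambda>j. (f (x + (1 / real (Suc j)) *\<^sub>R d) - f x) / (1 / real (Suc j))) \<longlonglongrightarrow> D d"
    by (rule lipschitz_directional_derivative[OF lip D])
       (use LIMSEQ_inverse_real_of_nat in \<open>auto simp: inverse_eq_divide\<close>)
  then have "D d \<le> L * norm d"
  proof (rule LIMSEQ_le_const2, intro exI allI impI)
    fix j
    have "f (x + (1 / real (Suc j)) *\<^sub>R d) - f x \<le> L * (norm d / real (Suc j))"
      using lipschitz_abs_diff_le[OF lip, of "x + (1 / real (Suc j)) *\<^sub>R d" x] by simp
    then show "(f (x + (1 / real (Suc j)) *\<^sub>R d) - f x) / (1 / real (Suc j)) \<le> L * norm d"
      by (simp add: field_simps)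
  qed
  then have "norm d * norm d \<le> L * norm d"
    by (simp add: Dd flip: power2_norm_eq_inner power2_eq_square)
  then have "norm d \<le> L"
    using lipschitz_on_nonneg[OF lip] by (cases "norm d = 0") (auto simp: mult_le_cancel_right)
  with Dd show ?thesis
    by (rule that)
qed

lemma correlated_energy_0:
  fixes f :: "'a::euclidean_space \<Rightarrow> real"
  assumes lip: "L-lipschitz_on UNIV f"
  shows "correlated_energy f 0 = 2 * gaussian.variance f"
proof -
  note [measurable] = lipschitz_borel_measurable[OF lip]
  note int = integrable_gaussian_lipschitz[OF lip] integrable_gaussian_lipschitz_square[OF lip]
  have ints: "integrable gaussian (\<lambda>p::'a \<times> 'a. (f (fst p))\<^sup>2)"
    "integrable gaussian (\<lambda>p::'a \<times> 'a. (f (snd p))\<^sup>2)"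
    using int(2) by (subst integrable_distr_eq[symmetric, where N = borel and g = fst] 
      integrable_distr_eq[symmetric, where N = borel and g = snd]; simp add: distr_gaussian_fst distr_gaussian_snd)+
  have "integrable gaussian (\<lambda>p::'a \<times> 'a. (f (fst p) - f (snd p))\<^sup>2)"
  proof (rule Bochner_Integration.integrable_bound)
    show "integrable gaussian (\<lambda>p::'a \<times> 'a. 2 * (f (fst p))\<^sup>2 + 2 * (f (snd p))\<^sup>2)"
      using ints by auto
    show "(\<lambda>p::'a \<times> 'a. (f (fst p) - f (snd p))\<^sup>2) \<in> borel_measurable gaussian"
      by measurable
    show "AE p::'a \<times> 'a in gaussian. norm ((f (fst p) - f (snd p))\<^sup>2)
        \<le> norm (2 * (f (fst p))\<^sup>2 + 2 * (f (snd p))\<^sup>2)"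
      using square_add_le[of "f _" "- f _"] by simp
  qed
  then have "correlated_energy f 0 = (\<integral>x. (\<integral>y. (f x - f y)\<^sup>2 \<partial>gaussian) \<partial>gaussian)"
    unfolding correlated_energy_def by (simp add: case_prod_unfold integral_gaussian_pair)
  also have "\<dots> = (\<integral>x. (\<integral>y. (f x)\<^sup>2 + (f y)\<^sup>2 - 2 * f x * f y \<partial>gaussian) \<partial>gaussian)"
    by (simp add: power2_diff)
  also have "\<dots> = (\<integral>x. (f x)\<^sup>2 + (\<integral>y. (f y)\<^sup>2 \<partial>gaussian) - 2 * f x * (\<integral>y. f y \<partial>gaussian) \<partial>gaussian)"
    using int gaussian.prob_space[where ?'a='a] by simp
  also have "\<dots> = 2 * (\<integral>x. (f x)\<^sup>2 \<partial>gaussian) - 2 * (\<integral>x. f x \<partial>gaussian)\<^sup>2"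
    using int gaussian.prob_space[where ?'a='a] by (simp add: power2_eq_square)
  also have "\<dots> = 2 * gaussian.variance f"
    by (simp add: gaussian.variance_eq[OF int])
  finally show ?thesis .
qed

text \<open>Doubling reduces the variance, half the energy at correlation \<open>0\<close>, to the energy at
  correlations close to \<open>1\<close>, where \<open>f\<close> can be replaced by its derivative.\<close>
theorem gaussian_poincare:
  fixes f :: "'a::euclidean_space \<Rightarrow> real"
  assumes lip: "L-lipschitz_on UNIV f" and diff: "AE x in gaussian. f differentiable (at x)"
  shows "gaussian.variance f \<le> L\<^sup>2"
proof -
  note [measurable] = lipschitz_borel_measurable[OF lip]
  \<comment> \<open>\<open>\<tau> j\<close> is the distance of the correlation from 1, and
    \<open>t j\<close> the order of the resulting displacement. As
    \<open>1 - (1 - \<tau> j)\<^sup>2 = \<tau> j * (2 - \<tau> j)\<close>, the correlated argument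
    is exactly \<open>x + t j *\<^sub>R w j x y\<close>, and \<open>2 ^ j\<close> times the energy
    is the mean of \<open>q j\<close>. The direction \<open>w j x y\<close> tends to
    \<open>sqrt 2 *\<^sub>R y\<close>, whence the factor 2 in the limit.\<close>
  define \<tau> t :: "nat \<Rightarrow> real" where "\<tau> = (\<lambda>j. 1 / 2 ^ j)" and "t = (\<lambda>j. sqrt (\<tau> j))"
  define w where "w = (\<lambda>j (x::'a) y. - (t j *\<^sub>R x) + sqrt (2 - \<tau> j) *\<^sub>R y)"
  define q where "q = (\<lambda>j x y. ((f (x + t j *\<^sub>R w j x y) - f x) / t j)\<^sup>2)"
  define h where "h = (\<lambda>j x. \<integral>y. q j x y \<partial>gaussian)"
  have tau: "0 < \<tau> j" "\<tau> j \<le> 1" for j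
    by (simp_all add: \<tau>_def)
  have t: "t j > 0" "(t j)\<^sup>2 = \<tau> j" "t j \<le> 1" for j
    using tau[of j] by (simp_all add: t_def)
  have tau0: "\<tau> \<longlonglongrightarrow> 0"
    using LIMSEQ_power_zero[of "1 / 2 :: real"] by (simp add: \<tau>_def power_one_over)
  then have t0: "t \<longlonglongrightarrow> 0"
    using tendsto_real_sqrt by (fastforce simp: t_def)
  have [measurable]: "(\<lambda>p. q j (fst p) (snd p)) \<in> borel_measurable (gaussian \<Otimes>\<^sub>M gaussian)" for j
    unfolding q_def w_def by measurable
  have [measurable]: "(\<lambda>y. q j x y) \<in> borel_measurable borel" for j x
    unfolding q_def w_def by measurable
  \<comment> \<open>A bound free of \<open>j\<close>: it dominates the integrands over
    \<open>y\<close> and, once integrated, the functions \<open>h j\<close> of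
    \<open>x\<close>.\<close>
  have q_le: "q j x y \<le> 4 * L\<^sup>2 * ((norm x)\<^sup>2 + (norm y)\<^sup>2)" for j x y
  proof -
    have "norm (w j x y) \<le> t j * norm x + sqrt (2 - \<tau> j) * norm y"
      using norm_triangle_ineq[of "- (t j *\<^sub>R x)" "sqrt (2 - \<tau> j) *\<^sub>R y"] t[of j] tau[of j]
      by (simp add: w_def)
    then have "(norm (w j x y))\<^sup>2 \<le> (t j * norm x + sqrt (2 - \<tau> j) * norm y)\<^sup>2"
      by (rule power_mono) simp
    also have "\<dots> \<le> 2 * (t j * norm x)\<^sup>2 + 2 * (sqrt (2 - \<tau> j) * norm y)\<^sup>2"
      by (rule square_add_le)
    also have "\<dots> = 2 * \<tau> j * (norm x)\<^sup>2 + 2 * (2 - \<tau> j) * (norm y)\<^sup>2"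
      using t[of j] tau[of j] by (simp add: power_mult_distrib)
    also have "\<dots> \<le> 4 * (norm x)\<^sup>2 + 4 * (norm y)\<^sup>2"
      using tau[of j] by (intro add_mono mult_right_mono) auto
    finally have nw: "(norm (w j x y))\<^sup>2 \<le> 4 * ((norm x)\<^sup>2 + (norm y)\<^sup>2)"
      by simp
    have "\<bar>f (x + t j *\<^sub>R w j x y) - f x\<bar> \<le> L * (t j * norm (w j x y))"
      using lipschitz_abs_diff_le[OF lip, of "x + t j *\<^sub>R w j x y" x] t(1)[of j] by simp
    then have "\<bar>(f (x + t j *\<^sub>R w j x y) - f x) / t j\<bar> \<le> L * norm (w j x y)"
      using t(1)[of j] by (simp add: abs_divide divide_le_eq mult_ac)
    then have "q j x y \<le> (L * norm (w j x y))\<^sup>2"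
      unfolding q_def by (metis abs_ge_zero power2_abs power_mono)
    also have "\<dots> \<le> L\<^sup>2 * (4 * ((norm x)\<^sup>2 + (norm y)\<^sup>2))"
      unfolding power_mult_distrib by (intro mult_left_mono nw) simp
    finally show ?thesis
      by (simp add: algebra_simps)
  qed
  have q_nonneg: "q j x y \<ge> 0" for j x y
    by (simp add: q_def)
  have int_y: "integrable gaussian (\<lambda>y::'a. 4 * L\<^sup>2 * ((norm x)\<^sup>2 + (norm y)\<^sup>2))" for x :: 'a
    by (intro integrable_mult_right Bochner_Integration.integrable_add integrable_gaussian_norm_square) auto
  have int_qy: "integrable gaussian (q j x)" for j x
    by (rule Bochner_Integration.integrable_bound[OF int_y[of x]])
       (use q_le[of j x] q_nonneg[of j x] in \<open>auto simp: abs_of_nonneg\<close>)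
  have int_q: "integrable gaussian (\<lambda>p. q j (fst p) (snd p))" for j
  proof (rule Bochner_Integration.integrable_bound)
    show "integrable gaussian (\<lambda>p::'a \<times> 'a. 4 * L\<^sup>2 * (norm p)\<^sup>2)"
      by (intro integrable_mult_right integrable_gaussian_norm_square)
    show "(\<lambda>p. q j (fst p) (snd p)) \<in> borel_measurable gaussian"
      by (simp flip: gaussian_pair)
    show "AE p in gaussian. norm (q j (fst p) (snd p)) \<le> norm (4 * L\<^sup>2 * (norm p)\<^sup>2)"
      using q_le q_nonneg by (auto simp: norm_prod_def)
  qed
  have energy: "2 ^ j * correlated_energy f (1 - 1 / 2 ^ j) = (\<integral>x. h j x \<partial>gaussian)" for j
  proof -
    have s: "sqrt (1 - (1 - \<tau> j)\<^sup>2) = t j * sqrt (2 - \<tau> j)"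
      by (simp add: t_def flip: real_sqrt_mult) (simp add: power2_eq_square algebra_simps)
    have arg: "(1 - \<tau> j) *\<^sub>R x + sqrt (1 - (1 - \<tau> j)\<^sup>2) *\<^sub>R y = x + t j *\<^sub>R w j x y" for x y
      using t(2)[of j] unfolding s w_def by (simp add: algebra_simps power2_eq_square)
    have "q j x y = 2 ^ j * (f x - f ((1 - \<tau> j) *\<^sub>R x + sqrt (1 - (1 - \<tau> j)\<^sup>2) *\<^sub>R y))\<^sup>2" for x y
      unfolding arg q_def power_divide t(2) by (simp add: \<tau>_def power2_commute)
    then have "2 ^ j * correlated_energy f (1 - \<tau> j) = (\<integral>p. q j (fst p) (snd p) \<partial>gaussian)"
      by (simp add: correlated_energy_def case_prod_unfold)
    then show ?thesis
      using integral_gaussian_pair[OF int_q[of j]] by (simp add: h_def \<tau>_def)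
  qed
  \<comment> \<open>The limit of \<open>h j x\<close> is twice the squared norm of the gradient. The
    maximum with \<open>2 * L\<^sup>2\<close> turns it into a constant, so the gradient never has to
    be integrated over \<open>x\<close>.\<close>
  have h_lim: "(\<lambda>j. max (h j x) (2 * L\<^sup>2)) \<longlonglongrightarrow> 2 * L\<^sup>2" if dif: "f differentiable (at x)" for x
  proof -
    obtain D where D: "(f has_derivative D) (at x)"
      using dif unfolding differentiable_def by blast
    obtain d where d: "\<And>h. D h = h \<bullet> d" "norm d \<le> L"
      using lipschitz_gradient[OF lip D] by blast
    have "(\<lambda>j. h j x) \<longlonglongrightarrow> (\<integral>y. 2 * (y \<bullet> d)\<^sup>2 \<partial>gaussian)"
      unfolding h_def
    proof (rule integral_dominated_convergence[OF _ _ int_y[of x]])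
      have "(\<lambda>j. q j x y) \<longlonglongrightarrow> 2 * (y \<bullet> d)\<^sup>2" for y
      proof -
        have "(\<lambda>j. w j x y) \<longlonglongrightarrow> - (0 *\<^sub>R x) + sqrt (2 - 0) *\<^sub>R y"
          unfolding w_def by (intro tendsto_intros t0 tau0)
        from lipschitz_directional_derivative[OF lip D t0 t(1) this]
        have "(\<lambda>j. q j x y) \<longlonglongrightarrow> (D (sqrt 2 *\<^sub>R y))\<^sup>2"
          unfolding q_def by (intro tendsto_power) simp
        then show ?thesis
          by (simp add: d power_mult_distrib)
      qed
      then show "AE y in gaussian. (\<lambda>j. q j x y) \<longlonglongrightarrow> 2 * (y \<bullet> d)\<^sup>2"
        by simp
    qed (use q_le q_nonneg in auto)
    also have "(\<integral>y. 2 * (y \<bullet> d)\<^sup>2 \<partial>gaussian) = 2 * (norm d)\<^sup>2"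
      by (simp add: integral_gaussian_inner_square)
    finally have "(\<lambda>j. max (h j x) (2 * L\<^sup>2)) \<longlonglongrightarrow> max (2 * (norm d)\<^sup>2) (2 * L\<^sup>2)"
      by (intro tendsto_max tendsto_const)
    moreover have "(norm d)\<^sup>2 \<le> L\<^sup>2"
      using d by (intro power_mono) auto
    ultimately show ?thesis
      by (simp add: max_absorb2)
  qed
  have h_le: "h j x \<le> 4 * L\<^sup>2 * ((norm x)\<^sup>2 + DIM('a))" for j x
  proof -
    have "h j x \<le> (\<integral>y. 4 * L\<^sup>2 * ((norm x)\<^sup>2 + (norm (y::'a))\<^sup>2) \<partial>gaussian)"
      unfolding h_def by (intro integral_mono int_qy int_y q_le)
    also have "\<dots> = 4 * L\<^sup>2 * ((norm x)\<^sup>2 + DIM('a))"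
      using gaussian.prob_space[where ?'a='a]
      by (simp add: integrable_gaussian_norm_square integral_gaussian_norm_square)
    finally show ?thesis .
  qed
  have h_nonneg: "h j x \<ge> 0" for j x
    by (simp add: h_def q_nonneg)
  have [measurable]: "h j \<in> borel_measurable gaussian" for j
    unfolding h_def by (rule gaussian.borel_measurable_lebesgue_integral) (simp add: case_prod_unfold)
  have "(\<lambda>j. \<integral>x. max (h j x) (2 * L\<^sup>2) \<partial>gaussian) \<longlonglongrightarrow> (\<integral>x. 2 * L\<^sup>2 \<partial>(gaussian :: 'a measure))"
  proof (rule integral_dominated_convergence)
    show "integrable gaussian (\<lambda>x::'a. 4 * L\<^sup>2 * ((norm x)\<^sup>2 + DIM('a)) + 2 * L\<^sup>2)"
      by (intro integrable_mult_right Bochner_Integration.integrable_add integrable_gaussian_norm_square) auto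
    show "AE x in gaussian. (\<lambda>j. max (h j x) (2 * L\<^sup>2)) \<longlonglongrightarrow> 2 * L\<^sup>2"
      using diff by (rule eventually_mono) (rule h_lim)
    have "norm (max (h j x) (2 * L\<^sup>2)) \<le> 4 * L\<^sup>2 * ((norm x)\<^sup>2 + DIM('a)) + 2 * L\<^sup>2" for j x
    proof -
      have "\<bar>max (h j x) (2 * L\<^sup>2)\<bar> \<le> h j x + 2 * L\<^sup>2"
        using h_nonneg[of j x] zero_le_power2[of L] by (auto simp: max_def)
      then show ?thesis
        using h_le[of j x] by simp
    qed
    then show "AE x in gaussian. norm (max (h j x) (2 * L\<^sup>2)) \<le> 4 * L\<^sup>2 * ((norm x)\<^sup>2 + DIM('a)) + 2 * L\<^sup>2" for j
      by simp
  qed auto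
  then have "(\<lambda>j. \<integral>x. max (h j x) (2 * L\<^sup>2) \<partial>gaussian) \<longlonglongrightarrow> 2 * L\<^sup>2"
    using gaussian.prob_space[where ?'a='a] by simp
  moreover have "correlated_energy f 0 \<le> (\<integral>x. max (h j x) (2 * L\<^sup>2) \<partial>gaussian)" for j
  proof -
    have int_h: "integrable gaussian (h j)"
    proof (rule Bochner_Integration.integrable_bound)
      show "integrable gaussian (\<lambda>x::'a. 4 * L\<^sup>2 * ((norm x)\<^sup>2 + DIM('a)))"
        by (intro integrable_mult_right Bochner_Integration.integrable_add integrable_gaussian_norm_square) auto
    qed (use h_le[of j] h_nonneg[of j] in \<open>auto simp: abs_of_nonneg\<close>)
    have "correlated_energy f 0 \<le> (\<integral>x. h j x \<partial>gaussian)"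
      using correlated_energy_0_le[OF lip] by (simp add: energy)
    also have "\<dots> \<le> (\<integral>x. max (h j x) (2 * L\<^sup>2) \<partial>gaussian)"
      using int_h by (intro integral_mono) auto
    finally show ?thesis .
  qed
  ultimately have "correlated_energy f 0 \<le> 2 * L\<^sup>2"
    by (intro LIMSEQ_le_const) auto
  then show ?thesis
    by (simp add: correlated_energy_0[OF lip])
qed

subsection \<open>Gaussian product measures\<close>

text \<open>An arbitrary enumeration \<open>e\<close> of the basis covers both vectors, indexed by
  coordinates, and matrices, indexed by pairs.\<close>

lemma distr_PiM_std_normal:
  fixes e :: "'i \<Rightarrow> 'a::euclidean_space"
  assumes fin: "finite I" and bij: "bij_betw e I Basis"
  shows "distr (PiM I (\<lambda>_. density lborel std_normal_density)) borel (\<lambda>f. \<Sum>i\<in>I. f i *\<^sub>R e i) = gaussian"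
proof -
  let ?N = "density lborel std_normal_density"
  let ?C = "\<lambda>x. \<lambda>i\<in>I. x \<bullet> e i"
  interpret N: prob_space ?N
    by (rule prob_space_std_normal)
  interpret product_sigma_finite "\<lambda>_. ?N" ..
  have sets_PiM [measurable_cong]: "sets (PiM I (\<lambda>_. ?N)) = sets (PiM I (\<lambda>_. borel))"
    by (intro sets_PiM_cong) auto
  have C_meas [measurable]: "?C \<in> borel \<rightarrow>\<^sub>M PiM I (\<lambda>_. borel)"
    by measurable
  \<comment> \<open>The coordinate map is treated first because a product measure is determined by
    its values on boxes; the basis expansion then inverts it.\<close>
  have "distr gaussian (PiM I (\<lambda>_. borel)) ?C = PiM I (\<lambda>_. ?N)"
  proof (rule PiM_eqI[OF fin])
    show "sets (distr gaussian (PiM I (\<lambda>_. borel)) ?C) = sets (PiM I (\<lambda>_. ?N))"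
      by (simp add: sets_PiM)
    fix A assume A: "\<And>i. i \<in> I \<Longrightarrow> A i \<in> sets ?N"
    have [measurable]: "A i \<in> sets borel" if "i \<in> I" for i
      using A[OF that] by simp
    let ?inv = "the_inv_into I e"
    have inv: "?inv b \<in> I" "e (?inv b) = b" if "b \<in> Basis" for b
      using that bij by (auto simp: bij_betw_def the_inv_into_into f_the_inv_into_f)
    have inv_e: "?inv (e i) = i" if "i \<in> I" for i
      using that bij by (auto simp: bij_betw_def the_inv_into_f_f)
    have box: "Pi\<^sub>E I A \<in> sets (PiM I (\<lambda>_. borel))"
      using fin by (intro sets_PiM_I_finite) auto
    have "emeasure (distr gaussian (PiM I (\<lambda>_. borel)) ?C) (Pi\<^sub>E I A) =
        emeasure gaussian (?C -` Pi\<^sub>E I A)"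
      using box by (subst emeasure_distr) auto
    also have "\<dots> = (\<integral>\<^sup>+x. ennreal (gaussian_density x) * indicator (?C -` Pi\<^sub>E I A) x \<partial>lborel)"
      unfolding gaussian_def using measurable_sets_borel[OF C_meas box]
      by (subst emeasure_density) auto
    also have "\<dots> = (\<integral>\<^sup>+x. (\<Prod>b\<in>Basis. ennreal (std_normal_density (x \<bullet> b)) *
        indicator (A (?inv b)) (x \<bullet> b)) \<partial>lborel)"
    proof (rule nn_integral_cong)
      fix x :: 'a
      have "(indicator (?C -` Pi\<^sub>E I A) x :: ennreal) = (\<Prod>b\<in>Basis. indicator (A (?inv b)) (x \<bullet> b))"
      proof (cases "\<forall>i\<in>I. x \<bullet> e i \<in> A i")
        case True
        then have "\<forall>b\<in>Basis. x \<bullet> b \<in> A (?inv b)"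
          using inv by metis
        with True show ?thesis
          by (auto simp: indicator_def PiE_iff intro!: prod.neutral[symmetric])
      next
        case False
        then obtain i where i: "i \<in> I" "x \<bullet> e i \<notin> A i"
          by blast
        then have "e i \<in> Basis" "x \<bullet> e i \<notin> A (?inv (e i))"
          using bij inv_e by (auto simp: bij_betw_def)
        then have "(\<Prod>b\<in>Basis. indicator (A (?inv b)) (x \<bullet> b) :: ennreal) = 0"
          by (intro prod_zero finite_Basis bexI[of _ "e i"]) auto
        with i show ?thesis
          by (auto simp: indicator_def PiE_iff)
      qed
      then show "ennreal (gaussian_density x) * indicator (?C -` Pi\<^sub>E I A) x =
          (\<Prod>b\<in>Basis. ennreal (std_normal_density (x \<bullet> b)) * indicator (A (?inv b)) (x \<bullet> b))"
        by (simp add: gaussian_density_prod prod.distrib prod_ennreal)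
    qed
    also have "\<dots> = (\<Prod>b\<in>Basis. \<integral>\<^sup>+x. ennreal (std_normal_density x) * indicator (A (?inv b)) x \<partial>lborel)"
      using inv by (intro nn_integral_lborel_prod) auto
    also have "\<dots> = (\<Prod>b\<in>Basis. emeasure ?N (A (?inv b)))"
      using inv A by (intro prod.cong) (auto simp: emeasure_density)
    also have "\<dots> = (\<Prod>i\<in>I. emeasure ?N (A i))"
      using inv_e by (subst prod.reindex_bij_betw[OF bij, symmetric]) (auto intro: prod.cong)
    finally show "emeasure (distr gaussian (PiM I (\<lambda>_. borel)) ?C) (Pi\<^sub>E I A) =
        (\<Prod>i\<in>I. emeasure ?N (A i))" .
  qed
  then have "distr (PiM I (\<lambda>_. ?N)) borel (\<lambda>f. \<Sum>i\<in>I. f i *\<^sub>R e i) =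
      distr (distr gaussian (PiM I (\<lambda>_. borel)) ?C) borel (\<lambda>f. \<Sum>i\<in>I. f i *\<^sub>R e i)"
    by simp
  also have "\<dots> = distr gaussian borel (\<lambda>x. \<Sum>i\<in>I. (x \<bullet> e i) *\<^sub>R e i)"
    by (subst distr_distr) (auto simp: o_def intro!: distr_cong sum.cong)
  also have "(\<lambda>x. \<Sum>i\<in>I. (x \<bullet> e i) *\<^sub>R e i) = (\<lambda>x. x)"
    using sum.reindex_bij_betw[OF bij, of "\<lambda>b. (_ \<bullet> b) *\<^sub>R b"] by (simp add: euclidean_representation)
  finally show ?thesis
    by (simp add: distr_id2)
qed

lemma std_gaussian_eq_gaussian: "std_gaussian = (gaussian :: (real^'N::finite) measure)"
proof -
  have bij: "bij_betw (\<lambda>i::'N. axis i (1::real)) UNIV Basis"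
    by (auto simp: bij_betw_def inj_on_def axis_eq_axis Basis_vec_def)
  have "vec_lambda f = (\<Sum>i\<in>UNIV. f i *\<^sub>R axis i (1::real))" for f :: "'N \<Rightarrow> real"
    by (simp add: vec_eq_iff axis_def if_distrib cong: if_cong)
  then have "(vec_lambda :: _ \<Rightarrow> real^'N) = (\<lambda>f. \<Sum>i\<in>UNIV. f i *\<^sub>R axis i 1)"
    by blast
  then show ?thesis
    unfolding std_gaussian_def using distr_PiM_std_normal[OF _ bij] by simp
qed

text \<open>Expectations over the abstract probability space become integrals over
  \<open>gaussian\<close> on the space of matrices.\<close>

lemma distr_iid_std_normal_matrix:
  fixes A :: "'a \<Rightarrow> real^'N::finite^'n::finite"
  assumes "prob_space M" "iid_std_normal_matrix M A"
  shows "A \<in> borel_measurable M" and "distr M borel A = gaussian"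
proof -
  interpret prob_space M by fact
  let ?N = "density lborel std_normal_density"
  let ?X = "\<lambda>(i, j) w. A w $ i $ j"
  let ?e = "\<lambda>(i::'n, j::'N). axis i (axis j (1::real))"
  have indep: "indep_vars (\<lambda>_. borel) ?X UNIV"
    and distrib: "\<And>i j. distributed M lborel (\<lambda>w. A w $ i $ j) std_normal_density"
    using assms(2) by (auto simp: iid_std_normal_matrix_def)
  have X_meas [measurable]: "?X p \<in> borel_measurable M" for p
    using distributed_measurable[OF distrib] by (cases p) auto
  have A_eq: "A w = (\<Sum>p\<in>UNIV. ?X p w *\<^sub>R ?e p)" for w
  proof -
    have "(\<Sum>p\<in>UNIV. ?X p w *\<^sub>R ?e p) $ i $ j = (\<Sum>p\<in>UNIV. if p = (i, j) then A w $ i $ j else 0)" for i j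
      unfolding sum_component by (intro sum.cong) (auto simp: axis_def split: prod.splits)
    then show ?thesis
      by (simp add: vec_eq_iff)
  qed
  show "A \<in> borel_measurable M"
  proof -
    have "(\<lambda>w. \<Sum>p\<in>UNIV. ?X p w *\<^sub>R ?e p) \<in> borel_measurable M"
      by (intro borel_measurable_sum borel_measurable_scaleR X_meas borel_measurable_const)
    then show ?thesis
      by (simp only: A_eq[symmetric])
  qed
  have bij: "bij_betw ?e UNIV Basis"
    by (auto simp: bij_betw_def inj_on_def axis_eq_axis Basis_vec_def)
  have "distr M (PiM UNIV (\<lambda>_. borel)) (\<lambda>w. \<lambda>p\<in>UNIV. ?X p w) = PiM UNIV (\<lambda>p. distr M borel (?X p))"
    using indep by (subst (asm) indep_vars_iff_distr_eq_PiM) auto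
  also have "(\<lambda>p. distr M borel (?X p)) = (\<lambda>_. ?N)"
  proof
    fix p :: "'n \<times> 'N"
    have "distr M borel (?X p) = distr M lborel (?X p)"
      by (rule distr_cong) auto
    then show "distr M borel (?X p) = ?N"
      using distributed_distr_eq_density[OF distrib] by (cases p) simp
  qed
  finally have law: "distr M (PiM UNIV (\<lambda>_. borel)) (\<lambda>w. \<lambda>p\<in>UNIV. ?X p w) = PiM UNIV (\<lambda>_. ?N)" .
  have "gaussian = distr (PiM UNIV (\<lambda>_. ?N)) borel (\<lambda>f. \<Sum>p\<in>UNIV. f p *\<^sub>R ?e p)"
    by (rule distr_PiM_std_normal[symmetric]) (simp_all add: bij)
  also have "\<dots> = distr M borel (\<lambda>w. \<Sum>p\<in>UNIV. ?X p w *\<^sub>R ?e p)"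
    unfolding law[symmetric] by (subst distr_distr) (auto simp: o_def)
  also have "\<dots> = distr M borel A"
    by (simp only: A_eq[symmetric])
  finally show "distr M borel A = gaussian" ..
qed

subsection \<open>One encoding step\<close>

lemma AE_gaussian_fst:
  assumes "AE x in (gaussian :: 'a::euclidean_space measure). P x"
  shows "AE p in (gaussian :: ('a \<times> 'b::euclidean_space) measure). P (fst p)"
proof -
  have "AE x in distr (gaussian :: ('a \<times> 'b) measure) borel fst. P x"
    using assms by (simp only: distr_gaussian_fst)
  then show ?thesis
    by (rule AE_distrD[rotated]) simp
qed

lemma integral_gaussian_fst:
  fixes f :: "'a::euclidean_space \<Rightarrow> real"
  assumes [measurable]: "f \<in> borel_measurable borel"
  shows "(\<integral>p. f (fst p) \<partial>(gaussian :: ('a \<times> 'b::euclidean_space) measure)) = (\<integral>x. f x \<partial>gaussian)"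
  by (subst distr_gaussian_fst[where ?'b='b, symmetric], subst integral_distr) auto

lemma integrable_gaussian_fst:
  fixes f :: "'a::euclidean_space \<Rightarrow> real"
  assumes [measurable]: "f \<in> borel_measurable borel"
  shows "integrable (gaussian :: ('a \<times> 'b::euclidean_space) measure) (\<lambda>p. f (fst p)) \<longleftrightarrow> integrable gaussian f"
  by (subst (2) distr_gaussian_fst[where ?'b='b, symmetric], subst integrable_distr_eq) auto

lemma integral_gaussian_snd:
  fixes f :: "'b::euclidean_space \<Rightarrow> real"
  assumes [measurable]: "f \<in> borel_measurable borel"
  shows "(\<integral>p. f (snd p) \<partial>(gaussian :: ('a::euclidean_space \<times> 'b) measure)) = (\<integral>x. f x \<partial>gaussian)"
  by (subst distr_gaussian_snd[where ?'a='a, symmetric], subst integral_distr) auto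

lemma integrable_gaussian_snd:
  fixes f :: "'b::euclidean_space \<Rightarrow> real"
  assumes [measurable]: "f \<in> borel_measurable borel"
  shows "integrable (gaussian :: ('a::euclidean_space \<times> 'b) measure) (\<lambda>p. f (snd p)) \<longleftrightarrow> integrable gaussian f"
  by (subst (2) distr_gaussian_snd[where ?'a='a, symmetric], subst integrable_distr_eq) auto

section \<open>The maximum over a spherical code and the model of one step\<close>

definition max_inner :: "'a::euclidean_space set \<Rightarrow> 'a \<Rightarrow> real" where
  "max_inner S g = Max ((\<lambda>b. g \<bullet> b) ` S)"

text \<open>For a finite nonempty \<open>S\<close> and \<open>b\<close> in \<open>S\<close> these
  are disjoint open cones that cover almost every \<open>g\<close>. On each of them
  \<open>max_inner S\<close> is linear and tie-breaking has no influence.\<close>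

definition strict_argmax :: "'a::euclidean_space set \<Rightarrow> 'a \<Rightarrow> 'a set" where
  "strict_argmax S b = {g. \<forall>b'\<in>S - {b}. g \<bullet> b' < g \<bullet> b}"

definition perp :: "'b::euclidean_space \<Rightarrow> 'b \<Rightarrow> 'b" where
  "perp e w = w - (w \<bullet> e) *\<^sub>R e"

lemma perp_linear: "linear (perp e)"
  by (rule linearI) (simp_all add: perp_def algebra_simps)

lemma perp_inner [simp]: "norm e = 1 \<Longrightarrow> perp e w \<bullet> e = 0"
  by (simp add: perp_def inner_diff_left flip: power2_norm_eq_inner)

lemma perp_borel_measurable [measurable]: "perp e \<in> borel_measurable borel"
  unfolding perp_def[abs_def] by measurable

lemma norm_perp_square: "norm e = 1 \<Longrightarrow> (norm (perp e w))\<^sup>2 = (norm w)\<^sup>2 - (w \<bullet> e)\<^sup>2"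
  unfolding power2_norm_eq_inner norm_eq_1
  by (simp add: perp_def inner_diff inner_commute power2_eq_square)

lemma norm_perp_le: "norm e = 1 \<Longrightarrow> norm (perp e w) \<le> norm w"
  by (rule power2_le_imp_le) (simp_all add: norm_perp_square)

lemma norm_axis_minus_perp_square:
  assumes "norm e = 1"
  shows "(norm (a *\<^sub>R e - k *\<^sub>R perp e w))\<^sup>2 = a\<^sup>2 + k\<^sup>2 * (norm (perp e w))\<^sup>2"
  unfolding power2_norm_eq_inner using assms[unfolded norm_eq_1] perp_inner[OF assms, of w]
  by (simp add: inner_diff inner_commute power2_eq_square)

text \<open>Conditionally on a residual of norm \<open>\<rho>\<close>, the next residual has the norm of a vector whose
  component along the residual is \<open>\<rho> - max_inner S g\<close> and whose orthogonal part is
  \<open>c\<close> times an independent Gaussian vector.\<close>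
definition step_norm :: "'b::euclidean_space \<Rightarrow> real \<Rightarrow> 'a::euclidean_space set \<Rightarrow> real \<Rightarrow> 'a \<times> 'b \<Rightarrow> real" where
  "step_norm e c S \<rho> p = norm ((\<rho> - max_inner S (fst p)) *\<^sub>R e - c *\<^sub>R perp e (snd p))"

lemma step_norm_nonneg: "step_norm e c S \<rho> p \<ge> 0"
  by (simp add: step_norm_def)

lemma step_norm_lipschitz_residual:
  assumes "norm e = 1"
  shows "\<bar>step_norm e c S \<rho> p - step_norm e c S \<rho>' p\<bar> \<le> \<bar>\<rho> - \<rho>'\<bar>"
  unfolding step_norm_def
  by (rule order_trans[OF norm_triangle_ineq3])
     (simp add: assms flip: scaleR_diff_left)

locale spherical_code =
  fixes S :: "'a::euclidean_space set" and c :: real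
  assumes fin: "finite S" and nonempty: "S \<noteq> {}" and norm_eq: "\<And>b. b \<in> S \<Longrightarrow> norm b = c"
    and c_pos: "c > 0"
begin

lemma inner_le_max_inner: "b \<in> S \<Longrightarrow> g \<bullet> b \<le> max_inner S g"
  unfolding max_inner_def using fin by auto

lemma max_inner_lipschitz: "c-lipschitz_on UNIV (max_inner S)"
proof (rule lipschitz_onI)
  have le: "max_inner S x - max_inner S y \<le> c * norm (x - y)" for x y
  proof -
    have "max_inner S x \<in> (\<lambda>b. x \<bullet> b) ` S"
      unfolding max_inner_def using fin nonempty by (intro Max_in) auto
    then obtain b where b: "b \<in> S" "max_inner S x = x \<bullet> b"
      by blast
    have "x \<bullet> b = y \<bullet> b + (x - y) \<bullet> b"
      by (simp add: inner_diff_left)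
    also have "\<dots> \<le> max_inner S y + norm (x - y) * norm b"
      using inner_le_max_inner[OF b(1)] norm_cauchy_schwarz by (rule add_mono)
    finally show ?thesis
      by (simp add: b norm_eq mult.commute)
  qed
  show "dist (max_inner S x) (max_inner S y) \<le> c * dist x y" for x y
    using le[of x y] le[of y x] by (auto simp: dist_norm norm_minus_commute abs_le_iff)
qed (use c_pos in simp)

lemma max_inner_borel_measurable [measurable]: "max_inner S \<in> borel_measurable borel"
  by (rule lipschitz_borel_measurable[OF max_inner_lipschitz])

lemma strict_argmax_borel [measurable]: "strict_argmax S b \<in> sets borel"
proof -
  have "strict_argmax S b = (\<Inter>b'\<in>S - {b}. {g. g \<bullet> b' < g \<bullet> b})"
    by (auto simp: strict_argmax_def)
  also have "open \<dots>"
    using fin by (intro open_INT ballI open_Collect_less continuous_intros) auto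
  finally show ?thesis
    by simp
qed

lemma max_inner_strict_argmax:
  assumes "b \<in> S" "g \<in> strict_argmax S b"
  shows "max_inner S g = g \<bullet> b"
  unfolding max_inner_def
proof (rule Max_eqI)
  show "y \<le> g \<bullet> b" if y: "y \<in> (\<lambda>b. g \<bullet> b) ` S" for y
  proof -
    obtain b' where "b' \<in> S" "y = g \<bullet> b'"
      using y by blast
    then show ?thesis
      using assms by (cases "b' = b") (auto simp: strict_argmax_def less_imp_le)
  qed
qed (use fin assms in auto)

lemma eventually_strict_argmax:
  assumes "g \<in> strict_argmax S b"
  shows "\<forall>\<^sub>F g' in nhds g. g' \<in> strict_argmax S b"
proof -
  have "\<forall>\<^sub>F g' in nhds g. g' \<bullet> b' < g' \<bullet> b" if "b' \<in> S - {b}" for b'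
  proof (rule eventually_nhds[THEN iffD2], intro exI conjI ballI)
    show "open {g'. g' \<bullet> b' < g' \<bullet> b}"
      by (intro open_Collect_less continuous_intros)
    show "g \<in> {g'. g' \<bullet> b' < g' \<bullet> b}"
      using that assms by (simp add: strict_argmax_def)
  qed simp
  then have "\<forall>\<^sub>F g' in nhds g. \<forall>b'\<in>S - {b}. g' \<bullet> b' < g' \<bullet> b"
    using fin by (intro eventually_ball_finite) auto
  then show ?thesis
    by (simp add: strict_argmax_def)
qed

lemma strict_argmax_disjoint: "disjoint_family_on (strict_argmax S) S"
  unfolding disjoint_family_on_def
proof (intro ballI impI equals0I)
  fix b b' g assume "b \<in> S" "b' \<in> S" "b \<noteq> b'" "g \<in> strict_argmax S b \<inter> strict_argmax S b'"
  then have "g \<bullet> b' < g \<bullet> b" "g \<bullet> b < g \<bullet> b'"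
    by (auto simp: strict_argmax_def)
  then show False
    by simp
qed

lemma AE_strict_argmax: "AE g in gaussian. \<exists>b\<in>S. g \<in> strict_argmax S b"
proof -
  have "AE g in gaussian. \<forall>(b, b')\<in>{p \<in> S \<times> S. fst p \<noteq> snd p}. g \<bullet> (b - b') \<noteq> 0"
    using fin by (intro AE_finite_allI) (auto intro!: AE_gaussian_inner_neq)
  then show ?thesis
  proof (rule eventually_mono)
    fix g assume neq: "\<forall>(b, b')\<in>{p \<in> S \<times> S. fst p \<noteq> snd p}. g \<bullet> (b - b') \<noteq> 0"
    have "max_inner S g \<in> (\<lambda>b. g \<bullet> b) ` S"
      unfolding max_inner_def using fin nonempty by (intro Max_in) auto
    then obtain b where b: "b \<in> S" "max_inner S g = g \<bullet> b"
      by blast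
    have "g \<bullet> b' < g \<bullet> b" if "b' \<in> S - {b}" for b'
      using neq that b inner_le_max_inner[of b' g] by (force simp: inner_diff_right)
    with b show "\<exists>b\<in>S. g \<in> strict_argmax S b"
      by (auto simp: strict_argmax_def)
  qed
qed

lemma max_inner_has_derivative:
  assumes "b \<in> S" "g \<in> strict_argmax S b"
  shows "(max_inner S has_derivative (\<lambda>h. h \<bullet> b)) (at g)"
proof (rule has_derivative_transform_eventually)
  show "((\<lambda>g. g \<bullet> b) has_derivative (\<lambda>h. h \<bullet> b)) (at g)"
    by (auto intro!: derivative_eq_intros)
  show "\<forall>\<^sub>F g' in at g. g' \<bullet> b = max_inner S g'"
    using eventually_strict_argmax[OF assms(2)] max_inner_strict_argmax[OF assms(1)]
    by (auto simp: eventually_at_filter elim!: eventually_mono)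
qed (use max_inner_strict_argmax[OF assms] in auto)

lemma variance_max_inner_le: "gaussian.variance (max_inner S) \<le> c\<^sup>2"
proof (rule gaussian_poincare[OF max_inner_lipschitz])
  show "AE g in gaussian. max_inner S differentiable (at g)"
    using AE_strict_argmax
    by (rule eventually_mono) (auto simp: differentiable_def intro: max_inner_has_derivative)
qed

lemma AE_max_inner_neq: "AE g in gaussian. max_inner S g \<noteq> \<rho>"
proof -
  have "AE g in gaussian. \<forall>b\<in>S. g \<bullet> b \<noteq> \<rho>"
  proof (rule AE_finite_allI[OF fin])
    fix b assume "b \<in> S"
    then have "b \<noteq> 0"
      using norm_eq[of b] c_pos by auto
    then show "AE g in gaussian. g \<bullet> b \<noteq> \<rho>"
      by (rule AE_gaussian_inner_neq)
  qed
  then show ?thesis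
  proof (rule eventually_mono)
    fix g assume *: "\<forall>b\<in>S. g \<bullet> b \<noteq> \<rho>"
    have "max_inner S g \<in> (\<lambda>b. g \<bullet> b) ` S"
      unfolding max_inner_def using fin nonempty by (intro Max_in) auto
    with * show "max_inner S g \<noteq> \<rho>"
      by auto
  qed
qed

lemma step_norm_borel_measurable [measurable]:
  assumes [measurable]: "f \<in> borel_measurable M" "g \<in> borel_measurable M" "h \<in> borel_measurable M"
  shows "(\<lambda>x. step_norm e c S (f x) (g x, h x)) \<in> borel_measurable M"
  unfolding step_norm_def by simp

context
  fixes e :: "'b::euclidean_space"
  assumes e: "norm e = 1"
begin

lemma step_norm_square:
  "(step_norm e c S \<rho> p)\<^sup>2 = (\<rho> - max_inner S (fst p))\<^sup>2 + c\<^sup>2 * (norm (perp e (snd p)))\<^sup>2"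
  unfolding step_norm_def norm_axis_minus_perp_square[OF e] ..

text \<open>The components along \<open>e\<close> and orthogonal to it are each
  \<open>c\<close>-Lipschitz in their own variable. Being orthogonal, they combine by Pythagoras
  exactly as the norm of the product space does; the triangle inequality would cost a factor
  \<open>sqrt 2\<close> and weaken the final bound.\<close>

lemma step_norm_lipschitz: "c-lipschitz_on UNIV (step_norm e c S \<rho>)"
proof (rule lipschitz_onI)
  fix p q :: "'a \<times> 'b"
  let ?m = "max_inner S"
  have "dist (step_norm e c S \<rho> p) (step_norm e c S \<rho> q) \<le>
      norm (((\<rho> - ?m (fst p)) *\<^sub>R e - c *\<^sub>R perp e (snd p)) - ((\<rho> - ?m (fst q)) *\<^sub>R e - c *\<^sub>R perp e (snd q)))"
    unfolding step_norm_def dist_norm real_norm_def by (rule norm_triangle_ineq3)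
  also have "\<dots> = norm ((?m (fst q) - ?m (fst p)) *\<^sub>R e - c *\<^sub>R perp e (snd p - snd q))"
    by (simp add: linear_diff[OF perp_linear] algebra_simps)
  also have "\<dots> \<le> c * dist p q"
  proof (rule power2_le_imp_le)
    have "(?m (fst q) - ?m (fst p))\<^sup>2 \<le> (c * norm (fst p - fst q))\<^sup>2"
      using lipschitz_abs_diff_le[OF max_inner_lipschitz, of "fst q" "fst p"]
      by (metis abs_ge_zero norm_minus_commute power2_abs power_mono)
    moreover have "(norm (perp e (snd p - snd q)))\<^sup>2 \<le> (norm (snd p - snd q))\<^sup>2"
      by (intro power_mono norm_perp_le e) simp
    ultimately have "(norm ((?m (fst q) - ?m (fst p)) *\<^sub>R e - c *\<^sub>R perp e (snd p - snd q)))\<^sup>2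
        \<le> c\<^sup>2 * (norm (fst p - fst q))\<^sup>2 + c\<^sup>2 * (norm (snd p - snd q))\<^sup>2"
      unfolding norm_axis_minus_perp_square[OF e]
      by (intro add_mono mult_left_mono) (simp_all add: power_mult_distrib)
    also have "\<dots> = (c * dist p q)\<^sup>2"
      by (simp add: dist_norm norm_prod_def power_mult_distrib distrib_left)
    finally show "(norm ((?m (fst q) - ?m (fst p)) *\<^sub>R e - c *\<^sub>R perp e (snd p - snd q)))\<^sup>2 \<le> (c * dist p q)\<^sup>2" .
  qed (use c_pos in simp)
  finally show "dist (step_norm e c S \<rho> p) (step_norm e c S \<rho> q) \<le> c * dist p q" .
qed (use c_pos in simp)

text \<open>Serves two purposes: the norm is differentiable only away from 0, and the next encoding
  step needs a residual that has a direction.\<close>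

lemma AE_step_norm_neq_0: "AE p in gaussian. step_norm e c S \<rho> p \<noteq> 0"
proof -
  have "AE p in gaussian. max_inner S (fst (p :: 'a \<times> 'b)) \<noteq> \<rho>"
    by (rule AE_gaussian_fst[OF AE_max_inner_neq])
  then show ?thesis
  proof (rule eventually_mono)
    fix p :: "'a \<times> 'b" assume "max_inner S (fst p) \<noteq> \<rho>"
    then have "0 < (\<rho> - max_inner S (fst p))\<^sup>2 + c\<^sup>2 * (norm (perp e (snd p)))\<^sup>2"
      by (intro add_pos_nonneg) auto
    then show "step_norm e c S \<rho> p \<noteq> 0"
      unfolding step_norm_square[symmetric] by auto
  qed
qed

lemma variance_step_norm_le: "gaussian.variance (step_norm e c S \<rho>) \<le> c\<^sup>2"
proof (rule gaussian_poincare[OF step_norm_lipschitz])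
  have "AE p in gaussian. \<exists>b\<in>S. fst (p :: 'a \<times> 'b) \<in> strict_argmax S b"
    by (rule AE_gaussian_fst[OF AE_strict_argmax])
  then show "AE p in gaussian. step_norm e c S \<rho> differentiable (at p)"
    using AE_step_norm_neq_0[of \<rho>]
  proof eventually_elim
    fix p :: "'a \<times> 'b"
    assume "\<exists>b\<in>S. fst p \<in> strict_argmax S b" and nz: "step_norm e c S \<rho> p \<noteq> 0"
    then obtain b where b: "b \<in> S" "fst p \<in> strict_argmax S b"
      by blast
    have "((\<lambda>p. max_inner S (fst p)) has_derivative (\<lambda>h. fst h \<bullet> b)) (at p)"
      by (rule has_derivative_compose[OF has_derivative_fst[OF has_derivative_ident]
          max_inner_has_derivative[OF b]])
    moreover have "((\<lambda>p. perp e (snd p)) has_derivative (\<lambda>h. perp e (snd h))) (at p)"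
      by (rule has_derivative_compose[OF has_derivative_snd[OF has_derivative_ident]
          linear_imp_has_derivative[OF perp_linear]])
    ultimately have "((\<lambda>p. (\<rho> - max_inner S (fst p)) *\<^sub>R e - c *\<^sub>R perp e (snd p)) has_derivative
        (\<lambda>h. (0 - fst h \<bullet> b) *\<^sub>R e - c *\<^sub>R perp e (snd h))) (at p)"
      by (rule has_derivative_diff[OF has_derivative_scaleR_left[OF has_derivative_diff[OF
            has_derivative_const]] has_derivative_scaleR_right])
    from differentiableI[OF has_derivative_compose[OF this has_derivative_norm]] nz
    show "step_norm e c S \<rho> differentiable (at p)"
      unfolding step_norm_def by simp
  qed
qed

text \<open>Projecting off \<open>e\<close> removes one of the \<open>DIM('b)\<close> unit
  variances. The missing \<open>c\<^sup>2\<close> is the source of the term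
  \<open>- (c l)\<^sup>2\<close> in the error.\<close>

lemma integral_step_norm_square:
  "(\<integral>p. (step_norm e c S \<rho> p)\<^sup>2 \<partial>gaussian) =
    (\<rho> - gaussian.expectation (max_inner S))\<^sup>2 + gaussian.variance (max_inner S) + c\<^sup>2 * (real DIM('b) - 1)"
proof -
  let ?m = "gaussian.expectation (max_inner S)"
  note int = integrable_gaussian_lipschitz[OF max_inner_lipschitz]
    integrable_gaussian_lipschitz_square[OF max_inner_lipschitz]
  have sq: "(\<rho> - max_inner S g)\<^sup>2 = \<rho>\<^sup>2 + (max_inner S g)\<^sup>2 - 2 * \<rho> * max_inner S g" for g
    by (rule power2_diff)
  have int1: "integrable gaussian (\<lambda>g. (\<rho> - max_inner S g)\<^sup>2)"
    unfolding sq by (intro Bochner_Integration.integrable_add Bochner_Integration.integrable_diff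
        integrable_mult_right int gaussian.integrable_const)
  have "(\<integral>g. (\<rho> - max_inner S g)\<^sup>2 \<partial>gaussian) = \<rho>\<^sup>2 + (\<integral>g. (max_inner S g)\<^sup>2 \<partial>gaussian) - 2 * \<rho> * ?m"
    unfolding sq using gaussian.prob_space[where ?'a='a] by (simp add: int)
  then have val1: "(\<integral>g. (\<rho> - max_inner S g)\<^sup>2 \<partial>gaussian) = (\<rho> - ?m)\<^sup>2 + gaussian.variance (max_inner S)"
    unfolding gaussian.variance_eq[OF int] by (simp add: power2_diff)
  have int2: "integrable gaussian (\<lambda>w. (norm (perp e w))\<^sup>2)"
    unfolding norm_perp_square[OF e]
    by (intro Bochner_Integration.integrable_diff integrable_gaussian_norm_square integrable_gaussian_inner_square)
  have val2: "(\<integral>w. (norm (perp e w))\<^sup>2 \<partial>gaussian) = real DIM('b) - 1"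
    unfolding norm_perp_square[OF e]
    by (subst Bochner_Integration.integral_diff)
       (simp_all add: integrable_gaussian_norm_square integral_gaussian_norm_square
        integrable_gaussian_inner_square integral_gaussian_inner_square e)
  have "(\<integral>p. (step_norm e c S \<rho> p)\<^sup>2 \<partial>gaussian) =
      (\<integral>p. (\<rho> - max_inner S (fst p))\<^sup>2 \<partial>(gaussian :: ('a \<times> 'b) measure)) +
      (\<integral>p. c\<^sup>2 * (norm (perp e (snd p)))\<^sup>2 \<partial>(gaussian :: ('a \<times> 'b) measure))"
    unfolding step_norm_square
  proof (rule Bochner_Integration.integral_add)
    show "integrable (gaussian :: ('a \<times> 'b) measure) (\<lambda>p. (\<rho> - max_inner S (fst p))\<^sup>2)"
      using int1 by (subst integrable_gaussian_fst) auto
    show "integrable (gaussian :: ('a \<times> 'b) measure) (\<lambda>p. c\<^sup>2 * (norm (perp e (snd p)))\<^sup>2)"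
      using int2 by (intro integrable_mult_right, subst integrable_gaussian_snd) auto
  qed
  also have "(\<integral>p. (\<rho> - max_inner S (fst p))\<^sup>2 \<partial>(gaussian :: ('a \<times> 'b) measure)) =
      (\<integral>g. (\<rho> - max_inner S g)\<^sup>2 \<partial>gaussian)"
    by (rule integral_gaussian_fst) measurable
  also have "(\<integral>p. c\<^sup>2 * (norm (perp e (snd p)))\<^sup>2 \<partial>(gaussian :: ('a \<times> 'b) measure)) =
      (\<integral>w. c\<^sup>2 * (norm (perp e w))\<^sup>2 \<partial>gaussian)"
    by (rule integral_gaussian_snd) measurable
  finally show ?thesis
    by (simp add: val1 val2)
qed

end

end

lemma (in prob_space) variance_le_second_moment_about:
  fixes Z :: "'a \<Rightarrow> real"
  assumes int: "integrable M Z" "integrable M (\<lambda>x. (Z x)\<^sup>2)"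
  shows "variance Z \<le> expectation (\<lambda>x. (Z x - a)\<^sup>2)"
proof -
  have "(Z x - a)\<^sup>2 = (Z x)\<^sup>2 + a\<^sup>2 - 2 * a * Z x" for x
    by (simp add: power2_diff)
  then have "expectation (\<lambda>x. (Z x - a)\<^sup>2) = expectation (\<lambda>x. (Z x)\<^sup>2) + a\<^sup>2 - 2 * a * expectation Z"
    using prob_space by (simp add: int)
  also have "\<dots> = variance Z + (expectation Z - a)\<^sup>2"
    unfolding variance_eq[OF int] by (simp add: power2_diff)
  finally show ?thesis
    by simp
qed

section \<open>Propagation of mean square and variance through one step\<close>

context spherical_code
begin

text \<open>The variance bound is the law of total variance. Given the previous norm
  \<open>\<rho>\<close>, the next one has conditional mean \<open>\<kappa> \<rho>\<close> and
  conditional variance at most \<open>c\<^sup>2\<close>; as an average of functions that are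
  1-Lipschitz in \<open>\<rho>\<close>, \<open>\<kappa>\<close> is 1-Lipschitz and cannot increase
  the variance of \<open>X\<close>. Only the law of \<open>Y\<close> enters, so \<open>Y\<close> and
  \<open>X\<close> may live on the same space, as successive residual norms do.\<close>

lemma step_recursion:
  fixes e :: "'b::euclidean_space" and X Y :: "'m::euclidean_space \<Rightarrow> real"
  assumes e: "norm e = 1"
    and [measurable]: "X \<in> borel_measurable borel" "Y \<in> borel_measurable borel"
    and X2: "integrable gaussian (\<lambda>x. (X x)\<^sup>2)"
    and law: "distr gaussian borel Y =
      distr (gaussian :: ('m \<times> 'a \<times> 'b) measure) borel (\<lambda>q. step_norm e c S (X (fst q)) (snd q))"
  shows "integrable gaussian (\<lambda>x. (Y x)\<^sup>2)"
    and "gaussian.variance Y \<le> gaussian.variance X + c\<^sup>2"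
    and "gaussian.expectation (\<lambda>x. (Y x)\<^sup>2) =
      (gaussian.expectation X - gaussian.expectation (max_inner S))\<^sup>2 + gaussian.variance X
      + gaussian.variance (max_inner S) + c\<^sup>2 * (real DIM('b) - 1)"
proof -
  let ?F = "\<lambda>\<rho> p. step_norm e c S \<rho> (p :: 'a \<times> 'b)"
  let ?W = "\<lambda>q :: 'm \<times> 'a \<times> 'b. ?F (X (fst q)) (snd q)"
  let ?m = "gaussian.expectation (max_inner S)"
  have lip: "c-lipschitz_on UNIV (?F \<rho>)" for \<rho>
    by (rule step_norm_lipschitz[OF e])
  have X1: "integrable gaussian X"
    by (rule gaussian.square_integrable_imp_integrable[OF _ X2]) measurable
  have [measurable]: "?F 0 \<in> borel_measurable borel"
    by (rule lipschitz_borel_measurable[OF lip])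
  have [measurable]: "?W \<in> borel_measurable gaussian"
  proof -
    have "(\<lambda>q. ?F (X (fst q)) (fst (snd q), snd (snd q))) \<in> borel_measurable (gaussian :: ('m \<times> 'a \<times> 'b) measure)"
      by (rule step_norm_borel_measurable; measurable)
    then show ?thesis
      by simp
  qed
  have F_le: "?F \<rho> p \<le> \<bar>\<rho>\<bar> + ?F 0 p" for \<rho> p
    using step_norm_lipschitz_residual[OF e, of c S \<rho> p 0] by simp
  have W2: "integrable gaussian (\<lambda>q. (?W q)\<^sup>2)"
  proof (rule Bochner_Integration.integrable_bound)
    have "integrable (gaussian :: ('m \<times> 'a \<times> 'b) measure) (\<lambda>q. (X (fst q))\<^sup>2)"
      using X2 by (subst integrable_gaussian_fst) auto
    moreover have "integrable (gaussian :: ('m \<times> 'a \<times> 'b) measure) (\<lambda>q. (?F 0 (snd q))\<^sup>2)"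
      using integrable_gaussian_lipschitz_square[OF lip] by (subst integrable_gaussian_snd) auto
    ultimately show "integrable gaussian (\<lambda>q::'m \<times> 'a \<times> 'b. 2 * (X (fst q))\<^sup>2 + 2 * (?F 0 (snd q))\<^sup>2)"
      by simp
    have "(?W q)\<^sup>2 \<le> 2 * (X (fst q))\<^sup>2 + 2 * (?F 0 (snd q))\<^sup>2" for q
    proof -
      have "(?W q)\<^sup>2 \<le> (\<bar>X (fst q)\<bar> + ?F 0 (snd q))\<^sup>2"
        by (intro power_mono F_le step_norm_nonneg)
      also have "\<dots> \<le> 2 * (X (fst q))\<^sup>2 + 2 * (?F 0 (snd q))\<^sup>2"
        using square_add_le[of "\<bar>X (fst q)\<bar>" "?F 0 (snd q)"] by simp
      finally show ?thesis .
    qed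
    then show "AE q in gaussian. norm ((?W q)\<^sup>2) \<le> norm (2 * (X (fst q))\<^sup>2 + 2 * (?F 0 (snd q))\<^sup>2)"
      by simp
  qed measurable
  have W1: "integrable gaussian ?W"
    by (rule gaussian.square_integrable_imp_integrable[OF _ W2]) measurable

  have "integrable (distr gaussian borel Y) (\<lambda>y. y\<^sup>2)"
    unfolding law using W2 by (subst integrable_distr_eq) auto
  then show Y2: "integrable gaussian (\<lambda>x. (Y x)\<^sup>2)"
    by (subst (asm) integrable_distr_eq) auto
  have Y1: "integrable gaussian Y"
    by (rule gaussian.square_integrable_imp_integrable[OF _ Y2]) measurable
  have EY2: "gaussian.expectation (\<lambda>x. (Y x)\<^sup>2) = (\<integral>x. (\<integral>p. (?F (X x) p)\<^sup>2 \<partial>gaussian) \<partial>gaussian)"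
  proof -
    have "gaussian.expectation (\<lambda>x. (Y x)\<^sup>2) = (\<integral>y. y\<^sup>2 \<partial>distr gaussian borel Y)"
      by (subst integral_distr) auto
    also have "\<dots> = (\<integral>q. (?W q)\<^sup>2 \<partial>gaussian)"
      unfolding law by (subst integral_distr) auto
    finally show ?thesis
      by (simp add: integral_gaussian_pair[OF W2])
  qed
  define \<kappa> where "\<kappa> = (\<lambda>\<rho>. \<integral>p. ?F \<rho> p \<partial>gaussian)"
  have EY: "gaussian.expectation Y = (\<integral>x. \<kappa> (X x) \<partial>gaussian)"
  proof -
    have "gaussian.expectation Y = (\<integral>y. y \<partial>distr gaussian borel Y)"
      by (subst integral_distr) auto
    also have "\<dots> = (\<integral>q. ?W q \<partial>gaussian)"
      unfolding law by (subst integral_distr) auto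
    finally show ?thesis
      by (simp add: integral_gaussian_pair[OF W1] \<kappa>_def)
  qed
  have sq: "(X x - ?m)\<^sup>2 = (X x)\<^sup>2 + ?m\<^sup>2 - 2 * ?m * X x" for x
    by (simp add: power2_diff)
  have int_Xm: "integrable gaussian (\<lambda>x. (X x - ?m)\<^sup>2)"
    unfolding sq by (intro Bochner_Integration.integrable_add Bochner_Integration.integrable_diff
        integrable_mult_right X1 X2 gaussian.integrable_const)
  have "(\<integral>x. (X x - ?m)\<^sup>2 \<partial>gaussian) = (\<integral>x. (X x)\<^sup>2 \<partial>gaussian) + ?m\<^sup>2 - 2 * ?m * gaussian.expectation X"
    unfolding sq using gaussian.prob_space[where ?'a='m] by (simp add: X1 X2)
  also have "\<dots> = (gaussian.expectation X - ?m)\<^sup>2 + gaussian.variance X"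
    unfolding gaussian.variance_eq[OF X1 X2] by (simp add: power2_diff)
  finally show "gaussian.expectation (\<lambda>x. (Y x)\<^sup>2) =
      (gaussian.expectation X - ?m)\<^sup>2 + gaussian.variance X
      + gaussian.variance (max_inner S) + c\<^sup>2 * (real DIM('b) - 1)"
    using gaussian.prob_space[where ?'a='m]
    by (simp only: EY2 integral_step_norm_square[OF e]) (simp add: int_Xm)

  note intF = integrable_gaussian_lipschitz[OF lip] integrable_gaussian_lipschitz_square[OF lip]
  have kappa_lip: "\<bar>\<kappa> \<rho> - \<kappa> \<rho>'\<bar> \<le> \<bar>\<rho> - \<rho>'\<bar>" for \<rho> \<rho>'
  proof -
    have "\<bar>\<kappa> \<rho> - \<kappa> \<rho>'\<bar> = \<bar>\<integral>p. ?F \<rho> p - ?F \<rho>' p \<partial>gaussian\<bar>"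
      by (simp add: \<kappa>_def intF)
    also have "\<dots> \<le> (\<integral>p. \<bar>?F \<rho> p - ?F \<rho>' p\<bar> \<partial>gaussian)"
      by (rule integral_abs_bound)
    also have "\<dots> \<le> (\<integral>p. \<bar>\<rho> - \<rho>'\<bar> \<partial>(gaussian :: ('a \<times> 'b) measure))"
      by (intro integral_mono integrable_abs Bochner_Integration.integrable_diff intF gaussian.integrable_const
          step_norm_lipschitz_residual e)
    finally show ?thesis
      using gaussian.prob_space[where ?'a="'a \<times> 'b"] by simp
  qed
  have "1-lipschitz_on UNIV \<kappa>"
    by (rule lipschitz_onI) (use kappa_lip in \<open>auto simp: dist_real_def\<close>)
  then have [measurable]: "\<kappa> \<in> borel_measurable borel"
    by (rule lipschitz_borel_measurable)
  have moment: "(\<integral>p. (?F \<rho> p)\<^sup>2 \<partial>gaussian) \<le> c\<^sup>2 + (\<kappa> \<rho>)\<^sup>2" for \<rho>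
    using variance_step_norm_le[OF e, of \<rho>] unfolding gaussian.variance_eq[OF intF] by (simp add: \<kappa>_def)
  have kX2: "integrable gaussian (\<lambda>x. (\<kappa> (X x))\<^sup>2)"
  proof (rule Bochner_Integration.integrable_bound)
    show "integrable gaussian (\<lambda>x. 2 * (X x)\<^sup>2 + 2 * (\<kappa> 0)\<^sup>2)"
      using X2 by simp
    have "(\<kappa> \<rho>)\<^sup>2 \<le> 2 * \<rho>\<^sup>2 + 2 * (\<kappa> 0)\<^sup>2" for \<rho>
    proof -
      have "(\<kappa> \<rho> - \<kappa> 0)\<^sup>2 \<le> \<rho>\<^sup>2"
        using kappa_lip[of \<rho> 0] by (simp add: abs_le_square_iff)
      then show ?thesis
        using square_add_le[of "\<kappa> \<rho> - \<kappa> 0" "\<kappa> 0"] by simp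
    qed
    then show "AE x in gaussian. norm ((\<kappa> (X x))\<^sup>2) \<le> norm (2 * (X x)\<^sup>2 + 2 * (\<kappa> 0)\<^sup>2)"
      by simp
  qed measurable
  have kX1: "integrable gaussian (\<lambda>x. \<kappa> (X x))"
    by (rule gaussian.square_integrable_imp_integrable[OF _ kX2]) measurable
  let ?\<mu> = "gaussian.expectation X"
  have sq': "(X x - ?\<mu>)\<^sup>2 = (X x)\<^sup>2 + ?\<mu>\<^sup>2 - 2 * ?\<mu> * X x" for x
    by (simp add: power2_diff)
  have int_X\<mu>: "integrable gaussian (\<lambda>x. (X x - ?\<mu>)\<^sup>2)"
    unfolding sq' by (intro Bochner_Integration.integrable_add Bochner_Integration.integrable_diff
        integrable_mult_right X1 X2 gaussian.integrable_const)
  have k_le: "(\<kappa> (X x) - \<kappa> ?\<mu>)\<^sup>2 \<le> (X x - ?\<mu>)\<^sup>2" for x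
    using kappa_lip[of "X x" ?\<mu>] by (simp add: abs_le_square_iff)
  have int_k: "integrable gaussian (\<lambda>x. (\<kappa> (X x) - \<kappa> ?\<mu>)\<^sup>2)"
    by (rule Bochner_Integration.integrable_bound[OF int_X\<mu>]) (use k_le in auto)
  have "gaussian.expectation (\<lambda>x. (Y x)\<^sup>2) \<le> (\<integral>x. c\<^sup>2 + (\<kappa> (X x))\<^sup>2 \<partial>gaussian)"
  proof -
    have "integrable gaussian (\<lambda>x. \<integral>p. (?F (X x) p)\<^sup>2 \<partial>gaussian)"
      unfolding integral_step_norm_square[OF e]
      by (intro Bochner_Integration.integrable_add int_Xm gaussian.integrable_const)
    then show ?thesis
      unfolding EY2 using kX2 moment by (intro integral_mono) auto
  qed
  also have "\<dots> = c\<^sup>2 + (\<integral>x. (\<kappa> (X x))\<^sup>2 \<partial>gaussian)"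
    using kX2 gaussian.prob_space[where ?'a='m] by simp
  finally have "gaussian.variance Y \<le> c\<^sup>2 + gaussian.variance (\<lambda>x. \<kappa> (X x))"
    unfolding gaussian.variance_eq[OF Y1 Y2] gaussian.variance_eq[OF kX1 kX2] unfolding EY by simp
  \<comment> \<open>Centering at \<open>\<kappa> ?\<mu>\<close> instead of the mean of
    \<open>\<kappa> (X x)\<close> only enlarges the second moment, and it allows a pointwise
    comparison with \<open>(X x - ?\<mu>)\<^sup>2\<close>.\<close>
  also have "gaussian.variance (\<lambda>x. \<kappa> (X x)) \<le> (\<integral>x. (\<kappa> (X x) - \<kappa> ?\<mu>)\<^sup>2 \<partial>gaussian)"
    by (rule gaussian.variance_le_second_moment_about[OF kX1 kX2])
  also have "\<dots> \<le> gaussian.variance X"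
    by (intro integral_mono int_k int_X\<mu> k_le)
  finally show "gaussian.variance Y \<le> gaussian.variance X + c\<^sup>2"
    by simp
qed

end

subsection \<open>The law of the residual norm\<close>

lemma borel_measurable_matrix_vector_mult [measurable (raw)]:
  fixes f :: "'x \<Rightarrow> real^'N::finite^'n::finite"
  assumes "f \<in> borel_measurable M" "g \<in> borel_measurable M"
  shows "(\<lambda>x. f x *v g x) \<in> borel_measurable M"
  using assms
  by (rule borel_measurable_continuous_Pair)
     (auto simp: matrix_vector_mult_def intro!: continuous_intros)

lemma emeasure_gaussian_pair:
  fixes Q :: "('a::euclidean_space \<times> 'b::euclidean_space) set"
  assumes "Q \<in> sets borel"
  shows "emeasure gaussian Q = (\<integral>\<^sup>+x. emeasure gaussian (Pair x -` Q) \<partial>gaussian)"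
proof -
  have "Q \<in> sets ((gaussian :: 'a measure) \<Otimes>\<^sub>M (gaussian :: 'b measure))"
    using assms by (simp only: gaussian_pair sets_gaussian)
  from gaussian.emeasure_pair_measure_alt[OF this] show ?thesis
    by (simp add: gaussian_pair)
qed

lemma orthogonal_projection_exists:
  fixes S :: "'a::euclidean_space set"
  obtains P where "linear P" "\<And>x y. P x \<bullet> y = x \<bullet> P y" "\<And>x. P (P x) = P x"
    "\<And>b. b \<in> S \<Longrightarrow> P b = b" "\<And>v. (\<And>b. b \<in> S \<Longrightarrow> v \<bullet> b = 0) \<Longrightarrow> P v = 0"
proof -
  obtain B where B: "B \<subseteq> span S" "pairwise orthogonal B" "\<And>u. u \<in> B \<Longrightarrow> norm u = 1"
    "independent B" "span B = span S"
    using orthonormal_basis_subspace[of "span S"] subspace_span by metis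
  have finB: "finite B"
    using B(4) by (rule finiteI_independent)
  define P where "P = (\<lambda>x. \<Sum>u\<in>B. (x \<bullet> u) *\<^sub>R u)"
  have lin: "linear P"
    unfolding P_def
    by (rule linearI) (simp_all add: algebra_simps sum.distrib scaleR_sum_right)
  have sym: "P x \<bullet> y = x \<bullet> P y" for x y
    by (simp add: P_def inner_sum_left inner_sum_right inner_commute mult.commute)
  have "P u = u" if "u \<in> B" for u
  proof -
    have "P u = (\<Sum>v\<in>B. if v = u then u else 0)"
      unfolding P_def
    proof (rule sum.cong)
      fix v assume "v \<in> B"
      then show "(u \<bullet> v) *\<^sub>R v = (if v = u then u else 0)"
        using B(2) B(3)[OF that] that
        by (auto simp: pairwise_def orthogonal_def inner_commute norm_eq_1)
    qed simp
    then show ?thesis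
      using finB that by simp
  qed
  then have id: "P x = x" if "x \<in> span S" for x
    using linear_eq_on_span[OF lin linear_id, of B x] that B(5) by auto
  have "P x \<in> span S" for x
    unfolding P_def using B(1) by (intro span_sum span_scale) auto
  then have "P (P x) = P x" for x
    by (rule id)
  moreover have "P v = 0" if v: "\<And>b. b \<in> S \<Longrightarrow> v \<bullet> b = 0" for v
  proof -
    have "orthogonal v u" if "u \<in> span S" for u
      using orthogonal_to_span[OF that, of v] v by (simp add: orthogonal_def)
    then show ?thesis
      unfolding P_def using B(1) by (intro sum.neutral) (auto simp: orthogonal_def)
  qed
  ultimately show ?thesis
    using that[OF lin sym] id by (simp add: span_base)
qed

text \<open>The adjoint splits \<open>z\<close> into the orthogonal parts \<open>z - P z\<close> and
  \<open>P z\<close>, hence is isometric by Pythagoras.\<close>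

lemma gaussian_resample:
  fixes P :: "'a::euclidean_space \<Rightarrow> 'a"
  assumes lin: "linear P" and sym: "\<And>x y. P x \<bullet> y = x \<bullet> P y" and idem: "\<And>x. P (P x) = P x"
  shows "distr gaussian borel (\<lambda>(x, y). x - P x + P y) = gaussian"
proof (rule gaussian_coisometry)
  show "(case p of (x, y) \<Rightarrow> x - P x + P y) \<bullet> z = p \<bullet> (z - P z, P z)" for p z
    by (cases p) (simp add: algebra_simps sym)
  show "norm (z - P z, P z) = norm z" for z
  proof -
    have "z \<bullet> P z = P z \<bullet> P z"
      using sym[of z "P z"] by (simp add: idem)
    then show ?thesis
      by (simp add: norm_eq_sqrt_inner inner_diff inner_commute)
  qed
  show "linear (\<lambda>(x, y). x - P x + P y)"
    unfolding case_prod_unfold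
    by (rule linearI) (simp_all add: linear_add[OF lin] linear_scale[OF lin] algebra_simps)
qed

text \<open>For symmetric \<open>P\<close> this is the matrix of \<open>A\<close> after
  \<open>P\<close>. Acting row by row, it inherits linearity, symmetry and idempotence from
  \<open>P\<close>, so that resampling applies on the space of matrices.\<close>

definition row_map :: "(real^'N \<Rightarrow> real^'N) \<Rightarrow> real^'N^'n \<Rightarrow> real^'N^'n" where
  "row_map P A = (\<chi> i. P (A $ i))"

lemma row_map_mult:
  assumes "\<And>x y. P x \<bullet> y = x \<bullet> P y"
  shows "row_map P A *v v = A *v P v"
  by (simp add: vec_eq_iff matrix_vector_mul_component row_map_def assms)

context spherical_code
begin

text \<open>Ties are null, so an event may be measured cell by cell, with the maximizing codeword
  constant on each cell. The map \<open>\<psi>\<close> extracts the Gaussian vector that decides the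
  cell: from a matrix in one use, from a pair in the other.\<close>

lemma emeasure_gaussian_split:
  fixes \<psi> :: "'p::euclidean_space \<Rightarrow> 'a"
  assumes [measurable]: "\<psi> \<in> borel_measurable borel" and law: "distr gaussian borel \<psi> = gaussian"
    and [measurable]: "Q \<in> sets borel"
  shows "emeasure gaussian Q = (\<Sum>b\<in>S. emeasure gaussian {p \<in> Q. \<psi> p \<in> strict_argmax S b})"
proof -
  have "AE g in distr gaussian borel \<psi>. \<exists>b\<in>S. g \<in> strict_argmax S b"
    unfolding law by (rule AE_strict_argmax)
  then have ae: "AE p in gaussian. \<exists>b\<in>S. \<psi> p \<in> strict_argmax S b"
    by (rule AE_distrD[rotated]) simp
  have [measurable]: "{p \<in> Q. \<psi> p \<in> strict_argmax S b} \<in> sets borel" for b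
  proof -
    have "{p \<in> Q. \<psi> p \<in> strict_argmax S b} = Q \<inter> (\<psi> -` strict_argmax S b)"
      by blast
    then show ?thesis
      using measurable_sets_borel[OF assms(1) strict_argmax_borel] by simp
  qed
  have "emeasure gaussian Q = emeasure gaussian (\<Union>b\<in>S. {p \<in> Q. \<psi> p \<in> strict_argmax S b})"
    using fin by (intro emeasure_eq_AE eventually_mono[OF ae]) auto
  also have "\<dots> = (\<Sum>b\<in>S. emeasure gaussian {p \<in> Q. \<psi> p \<in> strict_argmax S b})"
    using strict_argmax_disjoint fin
    by (intro sum_emeasure[symmetric]) (auto simp: disjoint_family_on_def)
  finally show ?thesis .
qed

end

text \<open>The adjoint sends \<open>z\<close> to the rank-one matrix with rows
  \<open>(u $ i) *\<^sub>R z\<close>, of norm \<open>norm z\<close>. The vector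
  \<open>u v* A\<close> carries all correlations at once: its inner product with \<open>b\<close> is
  that of \<open>u\<close> with \<open>A *v b\<close>.\<close>

lemma gaussian_vector_matrix_mult:
  fixes u :: "real^'n::finite"
  assumes u: "norm u = 1"
  shows "distr gaussian borel (\<lambda>A :: real^'N::finite^'n. u v* A) = gaussian"
proof (rule gaussian_coisometry)
  show "(u v* A) \<bullet> z = A \<bullet> (\<chi> i. (u $ i) *\<^sub>R z)" for A :: "real^'N^'n" and z
    by (simp add: dot_lmul_matrix inner_vec_def[of A] inner_vec_def[of u] matrix_vector_mul_component)
  show "norm ((\<chi> i. (u $ i) *\<^sub>R z) :: real^'N^'n) = norm z" for z :: "real^'N"
  proof -
    have "(\<Sum>i\<in>UNIV. u $ i * u $ i) = 1"
      using u by (simp add: norm_eq_1 inner_vec_def)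
    then show ?thesis
      by (simp add: norm_eq_sqrt_inner inner_vec_def[of "\<chi> i. _ i *\<^sub>R z"] mult.assoc[symmetric]
          flip: sum_distrib_right)
  qed
  show "linear (\<lambda>A :: real^'N^'n. u v* A)"
    by (rule linearI) (simp_all add: vec_eq_iff vector_matrix_mult_def algebra_simps sum.distrib sum_distrib_left)
qed

text \<open>The summand \<open>\<xi> *\<^sub>R u\<close> fills the direction that \<open>perp u\<close> annihilates, so that the second
  component is a full standard Gaussian vector.\<close>
lemma gaussian_split_column:
  fixes u :: "real^'n::finite" and b :: "real^'N::finite"
  assumes u: "norm u = 1" and b: "norm b = c" "c > 0"
  shows "distr gaussian borel (\<lambda>(A :: real^'N^'n, \<xi> :: real).
      (u v* A, (1 / c) *\<^sub>R perp u (A *v b) + \<xi> *\<^sub>R u)) = gaussian"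
proof (rule gaussian_coisometry)
  \<comment> \<open>The adjoint: two rank-one matrices, orthogonal to each other because
    \<open>perp u y\<close> is orthogonal to \<open>u\<close>, whatever the angle between
    \<open>z\<close> and \<open>b\<close>. The scalar \<open>y \<bullet> u\<close> restores the norm
    that \<open>perp u\<close> takes from \<open>y\<close>.\<close>
  let ?V = "\<lambda>(z :: real^'N, y :: real^'n).
      ((\<chi> i. (u $ i) *\<^sub>R z + (perp u y $ i / c) *\<^sub>R b) :: real^'N^'n, y \<bullet> u)"
  have perp_sym: "perp u x \<bullet> y = x \<bullet> perp u y" for x y
    by (simp add: perp_def algebra_simps inner_commute)
  show "(case p of (A, \<xi>) \<Rightarrow> (u v* A, (1 / c) *\<^sub>R perp u (A *v b) + \<xi> *\<^sub>R u)) \<bullet> q = p \<bullet> ?V q"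
    for p :: "(real^'N^'n) \<times> real" and q
  proof -
    obtain A \<xi> z y where pq: "p = (A, \<xi>)" "q = (z, y)"
      by (cases p, cases q)
    have "(u v* A) \<bullet> z = (\<Sum>i\<in>UNIV. u $ i * (A $ i \<bullet> z))"
      by (simp add: dot_lmul_matrix inner_vec_def[of u] matrix_vector_mul_component)
    moreover have "perp u (A *v b) \<bullet> y = (\<Sum>i\<in>UNIV. (A $ i \<bullet> b) * perp u y $ i)"
      unfolding perp_sym by (simp add: inner_vec_def[of "A *v b"] matrix_vector_mul_component)
    ultimately show ?thesis
      by (simp add: pq inner_vec_def[of A] inner_add_left inner_add_right sum.distrib
          sum_distrib_left sum_divide_distrib inner_commute[of u y] mult_ac)
  qed
  show "norm (?V q) = norm q" for q
  proof -
    obtain z y where q: "q = (z, y)"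
      by (cases q)
    let ?p = "perp u y"
    have uu: "(\<Sum>i\<in>UNIV. u $ i * u $ i) = 1"
      using u by (simp add: norm_eq_1 inner_vec_def)
    have up: "(\<Sum>i\<in>UNIV. u $ i * ?p $ i) = 0"
      using perp_inner[OF u, of y] by (simp add: inner_vec_def mult.commute)
    have bb: "b \<bullet> b = c\<^sup>2"
      using b by (simp flip: power2_norm_eq_inner)
    have "fst (?V q) \<bullet> fst (?V q) =
        (\<Sum>i\<in>UNIV. (u $ i * u $ i) * (z \<bullet> z) + (u $ i * ?p $ i) * (2 * (z \<bullet> b) / c) + ?p $ i * ?p $ i)"
      unfolding q inner_vec_def[of "fst _"]
      using b(2) by (intro sum.cong)
        (simp_all add: inner_add_left inner_add_right bb inner_commute[of b z] power2_eq_square field_simps)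
    also have "\<dots> = (\<Sum>i\<in>UNIV. u $ i * u $ i) * (z \<bullet> z)
        + (\<Sum>i\<in>UNIV. u $ i * ?p $ i) * (2 * (z \<bullet> b) / c) + ?p \<bullet> ?p"
      by (simp only: sum.distrib sum_distrib_right inner_vec_def[of ?p] inner_real_def)
    also have "\<dots> = z \<bullet> z + ?p \<bullet> ?p"
      by (simp add: uu up)
    also have "?p \<bullet> ?p = y \<bullet> y - (y \<bullet> u)\<^sup>2"
      using norm_perp_square[OF u, of y] by (simp add: power2_norm_eq_inner)
    finally show ?thesis
      by (simp add: q norm_eq_sqrt_inner power2_eq_square)
  qed
  show "linear (\<lambda>(A :: real^'N^'n, \<xi> :: real). (u v* A, (1 / c) *\<^sub>R perp u (A *v b) + \<xi> *\<^sub>R u))"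
    unfolding case_prod_unfold
    by (rule linearI)
       (simp_all add: vec_eq_iff vector_matrix_mult_def matrix_vector_mult_add_rdistrib
          scaleR_matrix_vector_assoc[symmetric] linear_add[OF perp_linear] linear_scale[OF perp_linear]
          algebra_simps sum.distrib sum_distrib_left)
qed

context spherical_code
begin

text \<open>A rotation of the second factor carries \<open>u\<close> to \<open>e\<close>. The
  conditional law of the next norm therefore depends on the residual through its norm alone, and one
  fixed direction \<open>e\<close> serves for all residuals.\<close>

lemma distr_step_norm_direction:
  fixes u e :: "real^'n::finite"
  assumes u: "norm u = 1" and e: "norm e = 1"
  shows "distr gaussian borel (step_norm u c S \<rho>) = distr gaussian borel (step_norm e c S \<rho>)"
proof -
  obtain f where f: "orthogonal_transformation f" "f u = e"
    using orthogonal_transformation_exists[of u e] u e by auto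
  then have lin: "linear f" and iso: "\<And>x. norm (f x) = norm x"
    and inner: "\<And>x y. f x \<bullet> f y = x \<bullet> y"
    by (auto simp: orthogonal_transformation_def orthogonal_transformation_norm)
  let ?f = "\<lambda>p :: 'a \<times> (real^'n). (fst p, f (snd p))"
  have lin': "linear ?f"
    by (rule linearI) (simp_all add: linear_add[OF lin] linear_scale[OF lin])
  have [measurable]: "?f \<in> borel_measurable borel"
    by (rule linear_borel_measurable[OF lin'])
  have [measurable]: "step_norm e c S \<rho> \<in> borel_measurable borel"
    by (rule lipschitz_borel_measurable[OF step_norm_lipschitz[OF e]])
  have "step_norm e c S \<rho> (?f p) = step_norm u c S \<rho> p" for p
  proof -
    have "perp e (f (snd p)) = f (perp u (snd p))"
      by (simp add: perp_def linear_diff[OF lin] linear_scale[OF lin] inner flip: f(2))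
    then have "(\<rho> - max_inner S (fst p)) *\<^sub>R e - c *\<^sub>R perp e (f (snd p)) =
        f ((\<rho> - max_inner S (fst p)) *\<^sub>R u - c *\<^sub>R perp u (snd p))"
      by (simp add: linear_diff[OF lin] linear_scale[OF lin] f(2))
    then show ?thesis
      by (simp add: step_norm_def iso)
  qed
  then have "distr gaussian borel (step_norm u c S \<rho>) = distr gaussian borel (step_norm e c S \<rho> \<circ> ?f)"
    by (simp add: o_def)
  also have "\<dots> = distr (distr gaussian borel ?f) borel (step_norm e c S \<rho>)"
    by (subst distr_distr) auto
  also have "distr gaussian borel ?f = gaussian"
    by (rule gaussian_isometry[OF lin']) (simp add: norm_prod_def iso)
  finally show ?thesis .
qed

end

section \<open>The selection rule\<close>

lemma argmax_rule_in:
  assumes "argmax_rule S T"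
  shows "T r (\<lambda>b\<in>S. A *v b) \<in> S"
  using assms by (auto simp: argmax_rule_def is_arg_max_def)

text \<open>Since \<open>r \<bullet> (A *v b)\<close> equals \<open>(r v* A) \<bullet> b\<close>,
  the choice is decided by the vector \<open>r v* A\<close>; off ties all admissible rules
  agree.\<close>

lemma argmax_rule_strict_argmax:
  fixes r :: "real^'n::finite"
  assumes T: "argmax_rule S T" and b: "b \<in> S" "(r v* A) \<in> strict_argmax S b"
  shows "T r (\<lambda>b\<in>S. A *v b) = b"
proof (rule ccontr)
  let ?t = "T r (\<lambda>b\<in>S. A *v b)"
  assume "?t \<noteq> b"
  then have "(r v* A) \<bullet> ?t < (r v* A) \<bullet> b"
    using b(2) argmax_rule_in[OF T] by (auto simp: strict_argmax_def)
  then have "r \<bullet> (A *v ?t) < r \<bullet> (A *v b)"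
    by (simp add: dot_lmul_matrix)
  moreover have "\<forall>f\<in>extensional S. is_arg_max (\<lambda>b'. r \<bullet> f b') (\<lambda>b. b \<in> S) (T r f)"
    using T by (simp add: argmax_rule_def)
  then have "is_arg_max (\<lambda>b'. r \<bullet> (\<lambda>b\<in>S. A *v b) b') (\<lambda>b. b \<in> S) ?t"
    by (rule bspec) (rule restrict_extensional)
  ultimately show False
    using b(1) argmax_rule_in[OF T, of r A] by (auto simp: is_arg_max_def)
qed

lemma borel_measurable_argmax_rule:
  fixes T :: "real^'n::finite \<Rightarrow> (real^'N::finite \<Rightarrow> real^'n) \<Rightarrow> real^'N"
  assumes T: "argmax_rule S T"
    and [measurable]: "f \<in> borel_measurable M" "g \<in> borel_measurable M"
  shows "(\<lambda>x. T (f x) (\<lambda>b\<in>S. g x *v b)) \<in> borel_measurable M"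
proof -
  have "(\<lambda>(r, f). T r f) \<in> borel \<Otimes>\<^sub>M PiM S (\<lambda>_. borel) \<rightarrow>\<^sub>M borel"
    using T by (simp add: argmax_rule_def)
  moreover have "(\<lambda>x. (f x, \<lambda>b\<in>S. g x *v b)) \<in> M \<rightarrow>\<^sub>M borel \<Otimes>\<^sub>M PiM S (\<lambda>_. borel)"
    by (intro measurable_Pair measurable_restrict) measurable
  ultimately show ?thesis
    using measurable_compose by fastforce
qed

lemma strict_argmax_scale:
  assumes "k > 0"
  shows "k *\<^sub>R g \<in> strict_argmax S b \<longleftrightarrow> g \<in> strict_argmax S b"
  using assms by (simp add: strict_argmax_def)

locale spherical_matrix_code = spherical_code S c for S :: "(real^'N::finite) set" and c :: real
begin

text \<open>The chosen codeword depends on \<open>A\<close>, so its column need not be Gaussian. For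
  a fixed \<open>b\<close>, however, the part of \<open>A *v b\<close> orthogonal to
  \<open>u\<close> is independent of \<open>u v* A\<close>, and off ties \<open>u v* A\<close> alone
  decides the choice. Comparing the two laws on each cell separately allows \<open>b\<close> to be
  treated as a constant.\<close>

lemma greedy_step_law_fixed:
  fixes r e :: "real^'n::finite"
  assumes T: "argmax_rule S T" and r: "r \<noteq> 0" and e: "norm e = 1"
  shows "distr gaussian borel (\<lambda>A :: real^'N^'n. norm (r - A *v T r (\<lambda>b\<in>S. A *v b))) =
    distr gaussian borel (step_norm e c S (norm r))"
proof -
  define \<rho> u where "\<rho> = norm r" and "u = r /\<^sub>R norm r"
  have u: "norm u = 1" and r_eq: "r = \<rho> *\<^sub>R u" and rho: "\<rho> > 0"
    using r by (auto simp: u_def \<rho>_def)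
  let ?Z = "\<lambda>A :: real^'N^'n. norm (r - A *v T r (\<lambda>b\<in>S. A *v b))"
  let ?F = "step_norm u c S \<rho> :: (real^'N) \<times> (real^'n) \<Rightarrow> real"
  have [measurable]: "?Z \<in> borel_measurable borel"
    using borel_measurable_argmax_rule[OF T] by measurable
  have [measurable]: "?F \<in> borel_measurable borel"
    by (rule lipschitz_borel_measurable[OF step_norm_lipschitz[OF u]])
  have [measurable]: "(\<lambda>A :: real^'N^'n. u v* A) \<in> borel_measurable borel"
    by (rule linear_borel_measurable, rule linearI)
       (simp_all add: vec_eq_iff vector_matrix_mult_def algebra_simps sum.distrib sum_distrib_left)
  have "distr gaussian borel ?Z = distr gaussian borel ?F"
  proof (rule measure_eqI)
    fix X assume "X \<in> sets (distr gaussian borel ?Z)"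
    then have [measurable]: "X \<in> sets borel"
      by simp
    have vimage: "?Z -` X \<in> sets borel" "?F -` X \<in> sets borel"
      by (rule measurable_sets_borel; measurable)+
    have "emeasure gaussian {A \<in> ?Z -` X. u v* A \<in> strict_argmax S b} =
        emeasure gaussian {p \<in> ?F -` X. fst p \<in> strict_argmax S b}" if b: "b \<in> S" for b
    proof -
      let ?Phi = "\<lambda>(A :: real^'N^'n, \<xi> :: real). (u v* A, (1 / c) *\<^sub>R perp u (A *v b) + \<xi> *\<^sub>R u)"
      let ?Q = "{p \<in> ?F -` X. fst p \<in> strict_argmax S b}"
      let ?R = "{A \<in> ?Z -` X. u v* A \<in> strict_argmax S b}"
      have Q [measurable]: "?Q \<in> sets borel"
        by measurable
      have R [measurable]: "?R \<in> sets borel"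
        by measurable
      have Phi [measurable]: "?Phi \<in> borel_measurable borel"
        unfolding case_prod_unfold by measurable
      have "norm (r - A *v T r (\<lambda>b\<in>S. A *v b)) = ?F (?Phi (A, \<xi>))"
        if g: "u v* A \<in> strict_argmax S b" for A :: "real^'N^'n" and \<xi>
      proof -
        have "r v* A = \<rho> *\<^sub>R (u v* A)"
          unfolding r_eq by (simp add: vec_eq_iff vector_matrix_mult_def sum_distrib_left mult_ac)
        then have "r v* A \<in> strict_argmax S b"
          using g by (simp add: strict_argmax_scale[OF rho])
        then have "T r (\<lambda>b\<in>S. A *v b) = b"
          by (rule argmax_rule_strict_argmax[OF T b])
        moreover have "perp u ((1 / c) *\<^sub>R perp u (A *v b) + \<xi> *\<^sub>R u) = (1 / c) *\<^sub>R perp u (A *v b)"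
        proof -
          have "perp u u = 0" "perp u (perp u (A *v b)) = perp u (A *v b)"
            using u by (simp_all add: perp_def[of u u] perp_def[of u "perp u _"] norm_eq_1)
          then show ?thesis
            by (simp add: linear_add[OF perp_linear] linear_scale[OF perp_linear])
        qed
        moreover have "max_inner S (u v* A) = (A *v b) \<bullet> u"
          using max_inner_strict_argmax[OF b g]
          by (simp only: dot_lmul_matrix inner_commute[of u])
        moreover have "r - A *v b = (\<rho> - (A *v b) \<bullet> u) *\<^sub>R u - perp u (A *v b)"
          unfolding r_eq by (simp add: perp_def algebra_simps)
        ultimately show ?thesis
          using c_pos by (simp add: step_norm_def)
      qed
      \<comment> \<open>The auxiliary coordinate \<open>\<xi>\<close> is annihilated by
        \<open>perp u\<close> inside \<open>step_norm\<close>, so the event pulled back along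
        \<open>?Phi\<close> is a cylinder over \<open>?R\<close>.\<close>
      then have eq: "?Phi -` ?Q = fst -` ?R"
        by auto
      have "emeasure gaussian ?R = emeasure (distr (gaussian :: ((real^'N^'n) \<times> real) measure) borel fst) ?R"
        by (simp only: distr_gaussian_fst)
      also have "\<dots> = emeasure gaussian (fst -` ?R :: ((real^'N^'n) \<times> real) set)"
        by (subst emeasure_distr) auto
      also have "\<dots> = emeasure (distr gaussian borel ?Phi) ?Q"
        unfolding eq[symmetric] by (subst emeasure_distr) auto
      also have "\<dots> = emeasure gaussian ?Q"
        by (simp only: gaussian_split_column[OF u norm_eq[OF b] c_pos])
      finally show ?thesis .
    qed
    moreover have "emeasure gaussian (?Z -` X) =
        (\<Sum>b\<in>S. emeasure gaussian {A \<in> ?Z -` X. u v* A \<in> strict_argmax S b})"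
      by (rule emeasure_gaussian_split[OF _ gaussian_vector_matrix_mult[OF u] vimage(1)]) measurable
    moreover have "emeasure gaussian (?F -` X) =
        (\<Sum>b\<in>S. emeasure gaussian {p \<in> ?F -` X. fst p \<in> strict_argmax S b})"
      by (rule emeasure_gaussian_split[OF _ distr_gaussian_fst vimage(2)]) measurable
    ultimately show "emeasure (distr gaussian borel ?Z) X = emeasure (distr gaussian borel ?F) X"
      by (simp add: emeasure_distr)
  qed simp
  then show ?thesis
    unfolding distr_step_norm_direction[OF u e] \<rho>_def .
qed

text \<open>With \<open>P\<close> the projection onto the span of \<open>S\<close>, replacing the \<open>P\<close>-part of the rows of \<open>A\<close> by
  that of an independent copy \<open>A'\<close> preserves the law; the residual then depends on \<open>A\<close> only and the
  columns indexed by \<open>S\<close> on \<open>A'\<close> only.\<close>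
lemma greedy_step_law:
  fixes r :: "real^'N^'n::finite \<Rightarrow> real^'n" and e :: "real^'n"
  assumes T: "argmax_rule S T" and [measurable]: "r \<in> borel_measurable borel"
    and dep: "\<And>A A'. (\<And>v. (\<And>b. b \<in> S \<Longrightarrow> v \<bullet> b = 0) \<Longrightarrow> A *v v = A' *v v) \<Longrightarrow> r A = r A'"
    and nz: "AE A in gaussian. r A \<noteq> 0" and e: "norm e = 1"
  shows "distr gaussian borel (\<lambda>A. norm (r A - A *v T (r A) (\<lambda>b\<in>S. A *v b))) =
    distr (gaussian :: ((real^'N^'n) \<times> (real^'N) \<times> (real^'n)) measure) borel
      (\<lambda>q. step_norm e c S (norm (r (fst q))) (snd q))"
    (is "distr gaussian borel ?Y = distr gaussian borel ?W")
proof (rule measure_eqI)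
  obtain P where lin: "linear P" and sym: "\<And>x y :: real^'N. P x \<bullet> y = x \<bullet> P y"
    and idem: "\<And>x. P (P x) = P x" and id: "\<And>b. b \<in> S \<Longrightarrow> P b = b"
    and null: "\<And>v. (\<And>b. b \<in> S \<Longrightarrow> v \<bullet> b = 0) \<Longrightarrow> P v = 0"
    using orthogonal_projection_exists[of S] by blast
  let ?U = "\<lambda>(A :: real^'N^'n, A'). A - row_map P A + row_map P A'"
  have linR: "linear (row_map P :: real^'N^'n \<Rightarrow> _)"
    by (rule linearI) (simp_all add: row_map_def vec_eq_iff linear_add[OF lin] linear_scale[OF lin])
  have lawU: "distr gaussian borel ?U = gaussian"
    by (rule gaussian_resample[OF linR])
       (simp_all add: row_map_def inner_vec_def[of "_ :: real^'N^'n"] sym idem)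
  have [measurable]: "row_map P \<in> borel_measurable (borel :: (real^'N^'n) measure)"
    by (rule linear_borel_measurable[OF linR])
  have U [measurable]: "?U \<in> borel_measurable borel"
    unfolding case_prod_unfold by measurable
  have [measurable]: "?Y \<in> borel_measurable borel"
    using borel_measurable_argmax_rule[OF T] by measurable
  let ?Z = "\<lambda>r A. norm (r - A *v T r (\<lambda>b\<in>S. A *v b)) :: real"
  have Z [measurable]: "(\<lambda>p :: (real^'N^'n) \<times> (real^'N^'n). ?Z (r (fst p)) (snd p)) \<in> borel_measurable borel"
    using borel_measurable_argmax_rule[OF T] by measurable
  have Zr [measurable]: "?Z r0 \<in> borel_measurable borel" for r0
    using borel_measurable_argmax_rule[OF T] by measurable
  have W [measurable]: "?W \<in> borel_measurable borel"
  proof -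
    have "(\<lambda>q :: (real^'N^'n) \<times> (real^'N) \<times> (real^'n).
        step_norm e c S (norm (r (fst q))) (fst (snd q), snd (snd q))) \<in> borel_measurable borel"
      by (rule step_norm_borel_measurable; measurable)
    then show ?thesis
      by simp
  qed
  have [measurable]: "(step_norm e c S \<rho> :: (real^'N) \<times> (real^'n) \<Rightarrow> real) \<in> borel_measurable borel" for \<rho>
    by (rule lipschitz_borel_measurable[OF step_norm_lipschitz[OF e]])
  have YU: "?Y (?U (A, A')) = ?Z (r A) A'" for A A'
  proof -
    have mult: "?U (A, A') *v v = A *v v - A *v P v + A' *v P v" for v
      by (simp add: matrix_vector_mult_add_rdistrib matrix_vector_mult_diff_rdistrib
          row_map_mult[OF sym])
    have "r (?U (A, A')) = r A"
    proof (rule dep)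
      fix v assume "\<And>b. b \<in> S \<Longrightarrow> v \<bullet> b = 0"
      then show "?U (A, A') *v v = A *v v"
        using null[of v] unfolding mult by simp
    qed
    moreover have on_S: "?U (A, A') *v b = A' *v b" if "b \<in> S" for b
      unfolding mult by (simp add: id that)
    then have "(\<lambda>b\<in>S. ?U (A, A') *v b) = (\<lambda>b\<in>S. A' *v b)"
      by (rule restrict_ext)
    ultimately show ?thesis
      using on_S[OF argmax_rule_in[OF T, of "r A" A']] by simp
  qed
  fix X assume "X \<in> sets (distr gaussian borel ?Y)"
  then have X [measurable]: "X \<in> sets borel"
    by simp
  have "emeasure (distr gaussian borel ?Y) X = emeasure (distr (distr gaussian borel ?U) borel ?Y) X"
    by (simp only: lawU)
  also have "\<dots> = emeasure (gaussian :: ((real^'N^'n) \<times> (real^'N^'n)) measure)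
      ((\<lambda>p. ?Z (r (fst p)) (snd p)) -` X)"
  proof -
    have "(?Y \<circ> ?U) = (\<lambda>p. ?Z (r (fst p)) (snd p))"
      using YU by (auto simp: fun_eq_iff)
    then show ?thesis
      by (subst distr_distr) (auto simp: emeasure_distr)
  qed
  also have "\<dots> = (\<integral>\<^sup>+A. emeasure gaussian (?Z (r A) -` X) \<partial>gaussian)"
    using measurable_sets_borel[OF Z X] by (subst emeasure_gaussian_pair) (simp_all add: vimage_def)
  \<comment> \<open>With the first matrix fixed, the residual is a constant vector, almost surely
    nonzero, and the law for a fixed residual applies to the independent second matrix.\<close>
  also have "\<dots> = (\<integral>\<^sup>+A. emeasure gaussian
      ((step_norm e c S (norm (r A)) :: (real^'N) \<times> (real^'n) \<Rightarrow> real) -` X) \<partial>gaussian)"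
  proof (rule nn_integral_cong_AE, rule eventually_mono[OF nz])
    fix A assume "r A \<noteq> 0"
    from arg_cong[OF greedy_step_law_fixed[OF T this e], of "\<lambda>M. emeasure M X"]
    show "emeasure gaussian (?Z (r A) -` X) = emeasure gaussian
        ((step_norm e c S (norm (r A)) :: (real^'N) \<times> (real^'n) \<Rightarrow> real) -` X)"
      by (simp add: emeasure_distr)
  qed
  also have "\<dots> = emeasure (gaussian :: ((real^'N^'n) \<times> (real^'N) \<times> (real^'n)) measure) (?W -` X)"
    using measurable_sets_borel[OF W X] by (subst emeasure_gaussian_pair) (simp_all add: vimage_def)
  also have "\<dots> = emeasure (distr gaussian borel ?W) X"
    by (simp add: emeasure_distr)
  finally show "emeasure (distr gaussian borel ?Y) X = emeasure (distr gaussian borel ?W) X" .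
qed simp

end

subsection \<open>The recursion for the centerings\<close>

lemma greedy_residual_0: "greedy_residual B T A x 0 = x"
  by (simp add: greedy_residual_def)

lemma greedy_residual_Suc:
  "greedy_residual B T A x (Suc l) = greedy_residual B T A x l -
     A *v T (Suc l) (greedy_residual B T A x l) (\<lambda>b\<in>B (Suc l). A *v b)"
  by (simp add: greedy_residual_def matrix_vector_right_distrib)

text \<open>Expresses that the residual sees \<open>A\<close> only through the columns of the
  sections already processed. The hypothesis on the rules places the selected vector inside its
  section, where the two matrices agree.\<close>

lemma greedy_residual_cong:
  assumes "\<And>k. k \<in> {1..l} \<Longrightarrow> argmax_rule (B k) (T k)"
    and "\<And>k b. k \<in> {1..l} \<Longrightarrow> b \<in> B k \<Longrightarrow> A *v b = A' *v b"
  shows "greedy_residual B T A x l = greedy_residual B T A' x l"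
  using assms
proof (induction l)
  case (Suc l)
  have IH: "greedy_residual B T A x l = greedy_residual B T A' x l"
  proof (rule Suc.IH)
    show "argmax_rule (B k) (T k)" if "k \<in> {1..l}" for k
      using that by (intro Suc.prems(1)) auto
    show "A *v b = A' *v b" if "k \<in> {1..l}" "b \<in> B k" for k b
      using that by (intro Suc.prems(2)[of k b]) auto
  qed
  have eq: "A *v b = A' *v b" if "b \<in> B (Suc l)" for b
    using Suc.prems(2)[of "Suc l"] that by simp
  then have restr: "(\<lambda>b\<in>B (Suc l). A *v b) = (\<lambda>b\<in>B (Suc l). A' *v b)"
    by (rule restrict_ext)
  have "argmax_rule (B (Suc l)) (T (Suc l))"
    by (rule Suc.prems(1)) simp
  then have "T (Suc l) (greedy_residual B T A' x l) (\<lambda>b\<in>B (Suc l). A' *v b) \<in> B (Suc l)"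
    by (rule argmax_rule_in)
  then show ?case
    unfolding greedy_residual_Suc IH restr by (simp add: eq)
qed (simp add: greedy_residual_0)

lemma borel_measurable_greedy_residual:
  fixes x :: "real^'n::finite"
  assumes "\<And>k. k \<in> {1..l} \<Longrightarrow> argmax_rule (B k) (T k)"
  shows "(\<lambda>A :: real^'N::finite^'n. greedy_residual B T A x l) \<in> borel_measurable borel"
  using assms
proof (induction l)
  case (Suc l)
  have [measurable]: "(\<lambda>A :: real^'N^'n. greedy_residual B T A x l) \<in> borel_measurable borel"
    by (rule Suc.IH) (use Suc.prems in auto)
  have "argmax_rule (B (Suc l)) (T (Suc l))"
    by (rule Suc.prems) simp
  then have "(\<lambda>A :: real^'N^'n. T (Suc l) (greedy_residual B T A x l) (\<lambda>b\<in>B (Suc l). A *v b))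
      \<in> borel_measurable borel"
    by (rule borel_measurable_argmax_rule) measurable
  then show ?case
    unfolding greedy_residual_Suc by measurable
qed (simp add: greedy_residual_0)

lemma (in spherical_matrix_code) gaussian_width_eq:
  "gaussian_width S * c = gaussian.expectation (max_inner S)"
proof -
  have "Max ((\<lambda>b. z \<bullet> b / norm b) ` S) = max_inner S z / c" for z
  proof -
    have "Max ((\<lambda>t. t / c) ` (\<lambda>b. z \<bullet> b) ` S) = max_inner S z / c"
      unfolding max_inner_def using fin nonempty c_pos
      by (intro mono_Max_commute[symmetric]) (auto simp: mono_def divide_right_mono)
    moreover have "(\<lambda>t. t / c) ` (\<lambda>b. z \<bullet> b) ` S = (\<lambda>b. z \<bullet> b / norm b) ` S"
      unfolding image_image by (intro image_cong) (simp_all add: norm_eq)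
    ultimately show ?thesis
      by simp
  qed
  then show ?thesis
    using c_pos by (simp add: gaussian_width_def std_gaussian_eq_gaussian)
qed

lemma residual_norm_step:
  fixes B :: "nat \<Rightarrow> (real^'N::finite) set" and x :: "real^'n::finite"
    and T :: "nat \<Rightarrow> real^'n \<Rightarrow> (real^'N \<Rightarrow> real^'n) \<Rightarrow> real^'N"
  defines "R \<equiv> \<lambda>l (A :: real^'N^'n). norm (greedy_residual B T A x l)"
  assumes code: "additive_orthogonal_code L B c"
    and T: "\<And>l. l \<in> {1..L} \<Longrightarrow> argmax_rule (B l) (T l)" and l: "Suc l \<le> L"
    and nz: "AE A in gaussian. R l A \<noteq> 0" and int: "integrable gaussian (\<lambda>A. (R l A)\<^sup>2)"
  shows "AE A in gaussian. R (Suc l) A \<noteq> 0"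
    and "integrable gaussian (\<lambda>A. (R (Suc l) A)\<^sup>2)"
    and "gaussian.variance (R (Suc l)) \<le> gaussian.variance (R l) + (c (Suc l))\<^sup>2"
    and "gaussian.expectation (\<lambda>A. (R (Suc l) A)\<^sup>2) =
      (gaussian.expectation (R l) - gaussian_width (B (Suc l)) * c (Suc l))\<^sup>2 + gaussian.variance (R l)
      + gaussian.variance (max_inner (B (Suc l))) + (c (Suc l))\<^sup>2 * (real CARD('n) - 1)"
    and "gaussian.variance (max_inner (B (Suc l))) \<le> (c (Suc l))\<^sup>2"
proof -
  interpret spherical_matrix_code "B (Suc l)" "c (Suc l)"
    using code l by unfold_locales (auto simp: additive_orthogonal_code_def)
  obtain e :: "real^'n" where e: "norm e = 1"
    using norm_axis_1 by blast
  have rule: "argmax_rule (B (Suc l)) (T (Suc l))"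
    using l by (intro T) auto
  have meas: "(\<lambda>A :: real^'N^'n. greedy_residual B T A x k) \<in> borel_measurable borel" if "k \<le> L" for k
    using that by (intro borel_measurable_greedy_residual T) auto
  have [measurable]: "R l \<in> borel_measurable borel" "R (Suc l) \<in> borel_measurable borel"
    unfolding R_def using meas[of l] meas[of "Suc l"] l by (auto intro!: borel_measurable_norm)
  have law: "distr gaussian borel (R (Suc l)) =
      distr (gaussian :: ((real^'N^'n) \<times> (real^'N) \<times> (real^'n)) measure) borel
        (\<lambda>q. step_norm e (c (Suc l)) (B (Suc l)) (R l (fst q)) (snd q))"
    unfolding R_def greedy_residual_Suc
  proof (rule greedy_step_law[OF rule _ _ _ e])
    show "(\<lambda>A :: real^'N^'n. greedy_residual B T A x l) \<in> borel_measurable borel"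
      using l by (intro meas) simp
    show "AE A :: real^'N^'n in gaussian. greedy_residual B T A x l \<noteq> 0"
      using nz by (simp add: R_def)
    show "greedy_residual B T A x l = greedy_residual B T A' x l"
      if off: "\<And>v. (\<And>b. b \<in> B (Suc l) \<Longrightarrow> v \<bullet> b = 0) \<Longrightarrow> A *v v = A' *v v" for A A' :: "real^'N^'n"
    proof (rule greedy_residual_cong)
      show "argmax_rule (B k) (T k)" if "k \<in> {1..l}" for k
        using that l by (intro T) auto
      \<comment> \<open>Mutual orthogonality of the sections enters here: earlier codewords lie in
        the orthogonal complement of section \<open>Suc l\<close>, where the two matrices
        agree.\<close>
      show "A *v v = A' *v v" if "k \<in> {1..l}" "v \<in> B k" for k v
      proof (rule off)
        fix b assume "b \<in> B (Suc l)"
        moreover have "k \<in> {1..L}" "Suc l \<in> {1..L}" "k \<noteq> Suc l"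
          using that(1) l by auto
        ultimately show "v \<bullet> b = 0"
          using code that(2) unfolding additive_orthogonal_code_def by blast
      qed
    qed
  qed
  note step = step_recursion[OF e _ _ int law]
  show "integrable gaussian (\<lambda>A. (R (Suc l) A)\<^sup>2)"
    by (rule step(1)) measurable
  show "gaussian.variance (R (Suc l)) \<le> gaussian.variance (R l) + (c (Suc l))\<^sup>2"
    by (rule step(2)) measurable
  have "gaussian.expectation (\<lambda>A. (R (Suc l) A)\<^sup>2) =
      (gaussian.expectation (R l) - gaussian.expectation (max_inner (B (Suc l))))\<^sup>2 + gaussian.variance (R l)
      + gaussian.variance (max_inner (B (Suc l))) + (c (Suc l))\<^sup>2 * (real DIM(real^'n) - 1)"
    by (rule step(3)) measurable
  then show "gaussian.expectation (\<lambda>A. (R (Suc l) A)\<^sup>2) =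
      (gaussian.expectation (R l) - gaussian_width (B (Suc l)) * c (Suc l))\<^sup>2 + gaussian.variance (R l)
      + gaussian.variance (max_inner (B (Suc l))) + (c (Suc l))\<^sup>2 * (real CARD('n) - 1)"
    by (simp add: gaussian_width_eq)
  show "gaussian.variance (max_inner (B (Suc l))) \<le> (c (Suc l))\<^sup>2"
    by (rule variance_max_inner_le)
  let ?W = "\<lambda>q :: (real^'N^'n) \<times> (real^'N) \<times> (real^'n).
      step_norm e (c (Suc l)) (B (Suc l)) (R l (fst q)) (snd q)"
  have W [measurable]: "?W \<in> borel_measurable borel"
  proof -
    have "(\<lambda>q :: (real^'N^'n) \<times> (real^'N) \<times> (real^'n).
        step_norm e (c (Suc l)) (B (Suc l)) (R l (fst q)) (fst (snd q), snd (snd q))) \<in> borel_measurable borel"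
      by (rule step_norm_borel_measurable; measurable)
    then show ?thesis
      by simp
  qed
  \<comment> \<open>For each fixed value of the previous norm the zero set is null; integrating over
    that value gives the claim, which then passes to \<open>R (Suc l)\<close> by equality of
    laws.\<close>
  have "AE q in gaussian. ?W q \<noteq> 0"
  proof -
    have null: "emeasure gaussian {p :: (real^'N) \<times> (real^'n). step_norm e (c (Suc l)) (B (Suc l)) \<rho> p = 0} = 0" for \<rho>
    proof -
      have "{p :: (real^'N) \<times> (real^'n). step_norm e (c (Suc l)) (B (Suc l)) \<rho> p = 0} \<in> sets borel"
        using lipschitz_borel_measurable[OF step_norm_lipschitz[OF e, of \<rho>]] by simp
      with AE_step_norm_neq_0[OF e, of \<rho>] show ?thesis
        by (subst (asm) AE_iff_measurable[OF _ refl]) auto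
    qed
    have Q: "?W -` {0} \<in> sets borel"
      by (rule measurable_sets_borel[OF W]) simp
    have "emeasure gaussian (?W -` {0}) = 0"
      by (subst emeasure_gaussian_pair[OF Q]) (simp add: vimage_def null)
    with Q show ?thesis
      by (subst AE_iff_measurable[OF _ refl]) (auto simp: vimage_def)
  qed
  then have "AE y in distr gaussian borel (R (Suc l)). y \<noteq> 0"
    unfolding law by (subst AE_distr_iff) auto
  then show "AE A in gaussian. R (Suc l) A \<noteq> 0"
    by (rule AE_distrD[rotated]) simp
qed

text \<open>Nonvanishing and square integrability are hypotheses of the one-step lemma and have to
  travel with the variance bound. The source is deterministic and nonzero, so the induction starts
  with variance 0 and the empty sum.\<close>

lemma residual_norm_moments:
  fixes B :: "nat \<Rightarrow> (real^'N::finite) set" and x :: "real^'n::finite"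
    and T :: "nat \<Rightarrow> real^'n \<Rightarrow> (real^'N \<Rightarrow> real^'n) \<Rightarrow> real^'N"
  defines "R \<equiv> \<lambda>l (A :: real^'N^'n). norm (greedy_residual B T A x l)"
  assumes code: "additive_orthogonal_code L B c"
    and T: "\<And>l. l \<in> {1..L} \<Longrightarrow> argmax_rule (B l) (T l)" and x: "x \<noteq> 0" and l: "l \<le> L"
  shows "AE A in gaussian. R l A \<noteq> 0" and "integrable gaussian (\<lambda>A. (R l A)\<^sup>2)"
    and "gaussian.variance (R l) \<le> (\<Sum>k=1..l. (c k)\<^sup>2)"
proof -
  have "(AE A in gaussian. R l A \<noteq> 0) \<and> integrable gaussian (\<lambda>A. (R l A)\<^sup>2) \<and>
      gaussian.variance (R l) \<le> (\<Sum>k=1..l. (c k)\<^sup>2)"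
    using l
  proof (induction l)
    case 0
    then show ?case
      using x gaussian.prob_space[where ?'a="real^'N^'n"] by (simp add: R_def greedy_residual_0)
  next
    case (Suc l)
    then have "AE A in gaussian. R l A \<noteq> 0" "integrable gaussian (\<lambda>A. (R l A)\<^sup>2)"
      and V: "gaussian.variance (R l) \<le> (\<Sum>k=1..l. (c k)\<^sup>2)"
      by auto
    note step = residual_norm_step[OF code T Suc.prems this(1,2)[unfolded R_def]]
    show ?case
      using step(1,2,3) V unfolding R_def by simp
  qed
  then show "AE A in gaussian. R l A \<noteq> 0" "integrable gaussian (\<lambda>A. (R l A)\<^sup>2)"
    "gaussian.variance (R l) \<le> (\<Sum>k=1..l. (c k)\<^sup>2)"
    by auto
qed

theorem theorem2:
  fixes M :: "'a measure"
    and A :: "'a \<Rightarrow> real^'N::finite^'n::finite"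
    and B :: "nat \<Rightarrow> (real^'N) set"
    and c :: "nat \<Rightarrow> real"
    and L :: nat
    and T :: "nat \<Rightarrow> real^'n \<Rightarrow> (real^'N \<Rightarrow> real^'n) \<Rightarrow> real^'N"
    and x :: "real^'n"
    and \<sigma> :: real
  defines "\<omega> \<equiv> \<lambda>l. gaussian_width (B l)"
    and "D \<equiv> centering M A B T x"
  assumes "prob_space M"
    and "iid_std_normal_matrix M A"
    and "additive_orthogonal_code L B c"
    and "\<And>l. l \<in> {1..L} \<Longrightarrow> argmax_rule (B l) (T l)"
    and "\<sigma> > 0"
    and "norm x = sqrt (real CARD('n)) * \<sigma>"
  shows "D 0 = \<sigma>\<^sup>2 \<and>
    (\<exists>\<eta> :: nat \<Rightarrow> real. \<forall>l\<in>{1..L}.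
       D l = (sqrt (D (l - 1)) - \<omega> l * c l / sqrt (real CARD('n)))\<^sup>2 + (c l)\<^sup>2
               + \<eta> l / real CARD('n) \<and>
       \<bar>\<eta> l\<bar> \<le> 2 * (\<Sum>k=1..l. (c k)\<^sup>2))"
proof
  let ?n = "real CARD('n)"
  note code = assms(5) and T = assms(6)
  have n: "?n > 0"
    by simp
  interpret prob_space M by fact
  have x: "x \<noteq> 0"
    using assms(7,8) n by (metis mult_pos_pos norm_zero order_less_irrefl real_sqrt_gt_zero)
  define R where "R = (\<lambda>l (A :: real^'N^'n). norm (greedy_residual B T A x l))"
  define \<mu> where "\<mu> = (\<lambda>l. gaussian.expectation (R l))"
  show "D 0 = \<sigma>\<^sup>2"
    using n assms(8) by (simp add: D_def centering_def greedy_residual_0 prob_space power_mult_distrib)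
  have R_meas: "R l \<in> borel_measurable borel" if "l \<le> L" for l
  proof -
    have [measurable]: "(\<lambda>A :: real^'N^'n. greedy_residual B T A x l) \<in> borel_measurable borel"
      by (rule borel_measurable_greedy_residual) (use that T in auto)
    show ?thesis
      unfolding R_def by measurable
  qed
  have D: "D l = (\<mu> l)\<^sup>2 / ?n" if l: "l \<le> L" for l
  proof -
    have "\<mu> l = (\<integral>w. R l (A w) \<partial>M)"
      unfolding \<mu>_def distr_iid_std_normal_matrix(2)[OF assms(3,4), symmetric]
      by (rule integral_distr[OF distr_iid_std_normal_matrix(1)[OF assms(3,4)] R_meas[OF l]])
    then show ?thesis
      by (simp add: D_def centering_def R_def)
  qed
  have mu_nonneg: "\<mu> l \<ge> 0" for l
    by (simp add: \<mu>_def R_def)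
  \<comment> \<open>The recursion multiplied by \<open>?n\<close> and solved for the error. With
    \<open>sqrt (D l) = \<mu> l / sqrt ?n\<close> the recursion becomes an identity, and the content
    lies in the bound.\<close>
  define \<eta> where "\<eta> = (\<lambda>l. (\<mu> l)\<^sup>2 - (\<mu> (l - 1) - \<omega> l * c l)\<^sup>2 - ?n * (c l)\<^sup>2)"
  have "D l = (sqrt (D (l - 1)) - \<omega> l * c l / sqrt ?n)\<^sup>2 + (c l)\<^sup>2 + \<eta> l / ?n \<and>
      \<bar>\<eta> l\<bar> \<le> 2 * (\<Sum>k=1..l. (c k)\<^sup>2)" if l_in: "l \<in> {1..L}" for l
  proof
    obtain k where l: "l = Suc k" and k: "Suc k \<le> L"
      using l_in by (cases l) auto
    have "sqrt (D k) - \<omega> l * c l / sqrt ?n = (\<mu> k - \<omega> l * c l) / sqrt ?n"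
      using k mu_nonneg by (simp add: D real_sqrt_divide diff_divide_distrib)
    then have "(sqrt (D (l - 1)) - \<omega> l * c l / sqrt ?n)\<^sup>2 = (\<mu> k - \<omega> l * c l)\<^sup>2 / ?n"
      by (simp add: l power_divide)
    moreover have "D l = (\<mu> l)\<^sup>2 / ?n"
      using k l by (intro D) simp
    ultimately show "D l = (sqrt (D (l - 1)) - \<omega> l * c l / sqrt ?n)\<^sup>2 + (c l)\<^sup>2 + \<eta> l / ?n"
      using n by (simp add: \<eta>_def l field_simps)
    note prev = residual_norm_moments[OF code T x Suc_leD[OF k]]
    note step = residual_norm_step[OF code T k prev(1,2)]
    have int2: "integrable gaussian (\<lambda>A. (R l A)\<^sup>2)"
      unfolding R_def l by (rule step(2))
    have int1: "integrable gaussian (R l)"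
      by (rule gaussian.square_integrable_imp_integrable[OF _ int2])
         (use R_meas[of l] k in \<open>simp add: l\<close>)
    define V W where "V = (\<lambda>l. gaussian.variance (R l))" and "W = gaussian.variance (max_inner (B l))"
    have "V l = gaussian.expectation (\<lambda>A. (R l A)\<^sup>2) - (\<mu> l)\<^sup>2"
      unfolding V_def \<mu>_def by (rule gaussian.variance_eq[OF int1 int2])
    moreover have "gaussian.expectation (\<lambda>A. (R l A)\<^sup>2) =
        (\<mu> k - \<omega> l * c l)\<^sup>2 + V k + W + (c l)\<^sup>2 * (?n - 1)"
      unfolding V_def W_def \<mu>_def \<omega>_def l R_def by (rule step(4))
    ultimately have "\<eta> l = V k - V l + W - (c l)\<^sup>2"
      by (simp add: \<eta>_def l algebra_simps)
    moreover have "V l \<le> V k + (c l)\<^sup>2"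
      unfolding V_def R_def l by (rule step(3))
    moreover have "W \<le> (c l)\<^sup>2"
      unfolding W_def l by (rule step(5))
    moreover have "V k \<le> (\<Sum>k=1..k. (c k)\<^sup>2)"
      unfolding V_def R_def by (rule prev(3))
    moreover have "0 \<le> V l" "0 \<le> V k" "0 \<le> W"
      by (simp_all add: V_def W_def)
    moreover have "(\<Sum>k=1..l. (c k)\<^sup>2) = (\<Sum>k=1..k. (c k)\<^sup>2) + (c l)\<^sup>2"
      by (simp add: l)
    \<comment> \<open>From above, \<open>W \<le> (c l)\<^sup>2\<close> and
      \<open>0 \<le> V l\<close> leave at most \<open>V k\<close>, hence at most the sum over the
      earlier sections. From below, \<open>V l \<le> V k + (c l)\<^sup>2\<close> and
      \<open>0 \<le> W\<close> leave at least \<open>- 2 * (c l)\<^sup>2\<close>; the factor 2 is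
      spent on this side.\<close>
    ultimately show "\<bar>\<eta> l\<bar> \<le> 2 * (\<Sum>k=1..l. (c k)\<^sup>2)"
      using zero_le_power2[of "c l"] by (simp add: abs_le_iff)
  qed
  then show "\<exists>\<eta>. \<forall>l\<in>{1..L}.
      D l = (sqrt (D (l - 1)) - \<omega> l * c l / sqrt ?n)\<^sup>2 + (c l)\<^sup>2 + \<eta> l / ?n \<and>
      \<bar>\<eta> l\<bar> \<le> 2 * (\<Sum>k=1..l. (c k)\<^sup>2)"
    by blast
qed

end
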